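(* For $x\in[-\tfrac12,1]$ let $\overline{\varrho}(x)=\max\{\varrho(C): C \text{ a bivariate copula with } \phi(C)=x\}$, and let $u(x)=1-\tfrac23(1-x)^2$. Let $N\in\{1,2,\dots\}$ and $x\in I_N=[1-\tfrac{3}{2N},\,1-\tfrac{3}{2N+2})$, put $m=\tfrac{1-x}{3}\in[\tfrac1{2N+2},\tfrac1{2N}]$, let $\ell\in\{\tfrac1{2N},\tfrac1{2N+2}\}$ be an endpoint nearest to $m$ (if the two endpoints are equally near, either choice is allowed, and the two resulting values in the formula below coincide), and set $\Delta=|m-\ell|$. Then $$\overline{\varrho}(x)=1-6\ell(2m-\ell)-\frac{4\Delta^{3/2}}{\sqrt{N(N+1)}}=u(x)-\Bigl(\frac{4\Delta^{3/2}}{\sqrt{N(N+1)}}-6\Delta^2\Bigr).$$ In particular, the symmetric copula $C_x$ (constructed in the context) satisfies $\varrho(C_x)=\overline{\varrho}(x)$ and $\phi(C_x)=x$. Moreover, $C_x$ is the unique copula with these two properties. At the remaining endpoint $x=1$, one has $\overline{\varrho}(1)=1$, uniquely attained by the upper Fréchet copula $C_1(u,v)=\min\{u,v\}$.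
   Context: A bivariate copula is a bivariate distribution function $C$ on $[0,1]^2$ with uniform margins, $C(u,1)=u$, $C(1,v)=v$. It is symmetric if $C(u,v)=C(v,u)$. Spearman's rho and Spearman's footrule are $$\varrho(C)=12\int_{[0,1]^2}C(u,v)\,d\lambda_2(u,v)-3,\qquad \phi(C)=6\int_0^1C(t,t)\,dt-2,$$ with $\lambda_2$ Lebesgue measure on $[0,1]^2$. Construction of $C_x$ for $x\in[-\tfrac12,1)$. Let $\lambda$ be Lebesgue measure on $[0,1]$, $\lambda|_I$ its restriction to an interval $I$, $F_\#\mu$ the pushforward of $\mu$ under $F$, and $S(u,v)=(v,u)$. Let $m=\tfrac{1-x}3$, let $N\ge1$ be the unique integer with $x\in I_N=[1-\tfrac3{2N},1-\tfrac3{2N+2})$, and put $R=\tfrac1{2N+2}$, $L=\tfrac1{2N}$, $d_N=\tfrac1{L-R}=2N(N+1)$, $I_N^L=[1-3L,\,1-\tfrac32(L+R))$, $I_N^R=[1-\tfrac32(L+R),\,1-3R)$. Put $v=\sqrt{2(L-m)/d_N}$ and $\theta=2L-v$ if $x\in I_N^L$; $v=\sqrt{2(m-R)/d_N}$ and $\theta=2R+v$ if $x\in I_N^R$; and $p=1-d_Nv$ in both cases. Let $\alpha_k=1-\tfrac kN$, $\beta_k=\tfrac{k+1}N$, $\ell_L(t)=L-v+\tfrac tN$, $\ell_R(t)=R+\tfrac tN$. Define, for $0\le t\le Nv$ and $0\le s\le pL$ (resp. $0\le s\le pR$), $A_k^L(s)=(k\theta+Nv+s,\;k\theta+Nv+s+L)$,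 $B_k^L(t)=(k\theta+t,\;k\theta+t+\ell_L(t))$, $C_k^L(t)=(k\theta+t+\ell_L(t),\;(k+1)\theta+t)$, $A_k^R(s)=(k\theta+s,\;k\theta+s+R)$, $B_k^R(t)=(k\theta+pR+t,\;k\theta+pR+t+\ell_R(t))$, $C_k^R(t)=(k\theta+pR+t+\ell_R(t),\;(k+1)\theta+pR+t)$. For $x\in I_N^L$ let $$\nu_x=\sum_{k=0}^{N-1}(A_k^L)_\#(\lambda|_{[0,pL]})+\sum_{k=0}^{N-1}\alpha_k(B_k^L)_\#(\lambda|_{[0,Nv]})+\sum_{k=0}^{N-1}\beta_k(C_k^L)_\#(\lambda|_{[0,Nv]}),$$ and for $x\in I_N^R$ let $$\nu_x=\sum_{k=0}^{N}(A_k^R)_\#(\lambda|_{[0,pR]})+\sum_{k=0}^{N-1}\alpha_k(B_k^R)_\#(\lambda|_{[0,Nv]})+\sum_{k=0}^{N-1}\beta_k(C_k^R)_\#(\lambda|_{[0,Nv]}).$$ Set $\pi_x=\nu_x+S_\#\nu_x$ (a probability measure on $[0,1]^2$ with uniform marginals) and $C_x(u,v)=\pi_x([0,u]\times[0,v])$. For $x=1$, $C_1(u,v)=\min\{u,v\}$. *)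

theory Defs
  imports "HOL-Probability.Probability"
begin

section \<open>Bivariate copulas, Spearman's rho and Spearman's footrule\<close>

text \<open>Copulas are functions on \<open>[0,1]\<^sup>2\<close>; they are represented by functions on \<open>\<real>\<^sup>2\<close> whose
  values outside the unit square are irrelevant: every notion below only inspects arguments in
  \<open>[0,1]\<close>, and equality of copulas is \<open>copula_eq\<close>. A bivariate distribution function on
  \<open>[0,1]\<^sup>2\<close> is the distribution function of a Borel probability measure on \<open>[0,1]\<^sup>2\<close>.\<close>

definition is_copula :: "(real \<Rightarrow> real \<Rightarrow> real) \<Rightarrow> bool" where
  "is_copula C \<longleftrightarrow>
     (\<exists>\<mu> :: (real \<times> real) measure.
        prob_space \<mu> \<and> sets \<mu> = sets borel \<and> measure \<mu> ({0..1} \<times> {0..1}) = 1 \<and>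
        (\<forall>u\<in>{0..1}. \<forall>v\<in>{0..1}. C u v = measure \<mu> ({0..u} \<times> {0..v}))) \<and>
     (\<forall>u\<in>{0..1}. C u 1 = u) \<and> (\<forall>v\<in>{0..1}. C 1 v = v)"

definition copula_eq :: "(real \<Rightarrow> real \<Rightarrow> real) \<Rightarrow> (real \<Rightarrow> real \<Rightarrow> real) \<Rightarrow> bool" where
  "copula_eq C D \<longleftrightarrow> (\<forall>u\<in>{0..1}. \<forall>v\<in>{0..1}. C u v = D u v)"

definition symmetric_copula :: "(real \<Rightarrow> real \<Rightarrow> real) \<Rightarrow> bool" where
  "symmetric_copula C \<longleftrightarrow> is_copula C \<and> (\<forall>u\<in>{0..1}. \<forall>v\<in>{0..1}. C u v = C v u)"

definition spearman_rho :: "(real \<Rightarrow> real \<Rightarrow> real) \<Rightarrow> real" where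
  "spearman_rho C = 12 * (LINT z:{0..1}\<times>{0..1}|lborel. C (fst z) (snd z)) - 3"

definition footrule :: "(real \<Rightarrow> real \<Rightarrow> real) \<Rightarrow> real" where
  "footrule C = 6 * (LINT t:{0..1}|lborel. C t t) - 2"

text \<open>The maximum of \<open>\<rho>\<close> under the constraint \<open>\<phi>(C) = x\<close>. The \<open>GREATEST\<close> operator
  is only meaningful if the maximum exists, so existence has to be asserted separately, by means of
  \<open>is_rho_maximizer\<close>.\<close>

definition rho_bar :: "real \<Rightarrow> real" where
  "rho_bar x = (GREATEST r. \<exists>C. is_copula C \<and> footrule C = x \<and> spearman_rho C = r)"

definition is_rho_maximizer :: "real \<Rightarrow> (real \<Rightarrow> real \<Rightarrow> real) \<Rightarrow> bool" where
  "is_rho_maximizer x C \<longleftrightarrow> is_copula C \<and> footrule C = x \<and>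
     (\<forall>D. is_copula D \<and> footrule D = x \<longrightarrow> spearman_rho D \<le> spearman_rho C)"

definition u_bound :: "real \<Rightarrow> real" where
  "u_bound x = 1 - 2/3 * (1 - x)\<^sup>2"

section \<open>The copulas \<open>C\<^sub>x\<close>\<close>

definition m_par :: "real \<Rightarrow> real" where
  "m_par x = (1 - x) / 3"

definition R_end :: "nat \<Rightarrow> real" where
  "R_end N = 1 / (2 * real N + 2)"

definition L_end :: "nat \<Rightarrow> real" where
  "L_end N = 1 / (2 * real N)"

definition d_par :: "nat \<Rightarrow> real" where
  "d_par N = 1 / (L_end N - R_end N)"

definition I_int :: "nat \<Rightarrow> real set" where
  "I_int N = {1 - 3 / (2 * real N) ..< 1 - 3 / (2 * real N + 2)}"

definition I_left :: "nat \<Rightarrow> real set" where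
  "I_left N = {1 - 3 * L_end N ..< 1 - 3/2 * (L_end N + R_end N)}"

definition I_right :: "nat \<Rightarrow> real set" where
  "I_right N = {1 - 3/2 * (L_end N + R_end N) ..< 1 - 3 * R_end N}"

definition N_of :: "real \<Rightarrow> nat" where
  "N_of x = (THE N. N \<ge> 1 \<and> x \<in> I_int N)"

definition v_left :: "nat \<Rightarrow> real \<Rightarrow> real" where
  "v_left N x = sqrt (2 * (L_end N - m_par x) / d_par N)"

definition v_right :: "nat \<Rightarrow> real \<Rightarrow> real" where
  "v_right N x = sqrt (2 * (m_par x - R_end N) / d_par N)"

definition theta_left :: "nat \<Rightarrow> real \<Rightarrow> real" where
  "theta_left N x = 2 * L_end N - v_left N x"

definition theta_right :: "nat \<Rightarrow> real \<Rightarrow> real" where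
  "theta_right N x = 2 * R_end N + v_right N x"

definition p_left :: "nat \<Rightarrow> real \<Rightarrow> real" where
  "p_left N x = 1 - d_par N * v_left N x"

definition p_right :: "nat \<Rightarrow> real \<Rightarrow> real" where
  "p_right N x = 1 - d_par N * v_right N x"

definition alpha_wt :: "nat \<Rightarrow> nat \<Rightarrow> real" where
  "alpha_wt N k = 1 - real k / real N"

definition beta_wt :: "nat \<Rightarrow> nat \<Rightarrow> real" where
  "beta_wt N k = (real k + 1) / real N"

definition ell_left :: "nat \<Rightarrow> real \<Rightarrow> real \<Rightarrow> real" where
  "ell_left N x t = L_end N - v_left N x + t / real N"

definition ell_right :: "nat \<Rightarrow> real \<Rightarrow> real" where
  "ell_right N t = R_end N + t / real N"

definition A_left :: "nat \<Rightarrow> real \<Rightarrow> nat \<Rightarrow> real \<Rightarrow> real \<times> real" where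
  "A_left N x k s =
     (real k * theta_left N x + real N * v_left N x + s,
      real k * theta_left N x + real N * v_left N x + s + L_end N)"

definition B_left :: "nat \<Rightarrow> real \<Rightarrow> nat \<Rightarrow> real \<Rightarrow> real \<times> real" where
  "B_left N x k t =
     (real k * theta_left N x + t,
      real k * theta_left N x + t + ell_left N x t)"

definition C_left :: "nat \<Rightarrow> real \<Rightarrow> nat \<Rightarrow> real \<Rightarrow> real \<times> real" where
  "C_left N x k t =
     (real k * theta_left N x + t + ell_left N x t,
      (real k + 1) * theta_left N x + t)"

definition A_right :: "nat \<Rightarrow> real \<Rightarrow> nat \<Rightarrow> real \<Rightarrow> real \<times> real" where
  "A_right N x k s =
     (real k * theta_right N x + s,
      real k * theta_right N x + s + R_end N)"

definition B_right :: "nat \<Rightarrow> real \<Rightarrow> nat \<Rightarrow> real \<Rightarrow> real \<times> real" where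
  "B_right N x k t =
     (real k * theta_right N x + p_right N x * R_end N + t,
      real k * theta_right N x + p_right N x * R_end N + t + ell_right N t)"

definition C_right :: "nat \<Rightarrow> real \<Rightarrow> nat \<Rightarrow> real \<Rightarrow> real \<times> real" where
  "C_right N x k t =
     (real k * theta_right N x + p_right N x * R_end N + t + ell_right N t,
      (real k + 1) * theta_right N x + p_right N x * R_end N + t)"

text \<open>The pushforward \<open>F\<^sub># (\<lambda>|\<^bsub>[0,a]\<^esub>)\<close>.\<close>

definition push_leb :: "(real \<Rightarrow> real \<times> real) \<Rightarrow> real \<Rightarrow> (real \<times> real) measure" where
  "push_leb F a = distr (restrict_space lborel {0..a}) borel F"

text \<open>Finite sums of Borel measures are formed setwise.\<close>

definition borel_measure_of :: "((real \<times> real) set \<Rightarrow> ennreal) \<Rightarrow> (real \<times> real) measure" where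
  "borel_measure_of f = measure_of UNIV (sets borel) f"

definition nu_left :: "nat \<Rightarrow> real \<Rightarrow> (real \<times> real) measure" where
  "nu_left N x = borel_measure_of (\<lambda>E.
       (\<Sum>k<N. emeasure (push_leb (A_left N x k) (p_left N x * L_end N)) E)
     + (\<Sum>k<N. ennreal (alpha_wt N k) * emeasure (push_leb (B_left N x k) (real N * v_left N x)) E)
     + (\<Sum>k<N. ennreal (beta_wt N k) * emeasure (push_leb (C_left N x k) (real N * v_left N x)) E))"

definition nu_right :: "nat \<Rightarrow> real \<Rightarrow> (real \<times> real) measure" where
  "nu_right N x = borel_measure_of (\<lambda>E.
       (\<Sum>k\<le>N. emeasure (push_leb (A_right N x k) (p_right N x * R_end N)) E)
     + (\<Sum>k<N. ennreal (alpha_wt N k) * emeasure (push_leb (B_right N x k) (real N * v_right N x)) E)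
     + (\<Sum>k<N. ennreal (beta_wt N k) * emeasure (push_leb (C_right N x k) (real N * v_right N x)) E))"

definition nu_meas :: "real \<Rightarrow> (real \<times> real) measure" where
  "nu_meas x = (if x \<in> I_left (N_of x) then nu_left (N_of x) x else nu_right (N_of x) x)"

definition pi_meas :: "real \<Rightarrow> (real \<times> real) measure" where
  "pi_meas x = borel_measure_of (\<lambda>E.
     emeasure (nu_meas x) E + emeasure (distr (nu_meas x) borel prod.swap) E)"

definition opt_copula :: "real \<Rightarrow> real \<Rightarrow> real \<Rightarrow> real" where
  "opt_copula x u v =
     (if x = 1 then min u v else measure (pi_meas x) ({0..u} \<times> {0..v}))"

section \<open>Well-definedness of \<open>N_of\<close> and of the setwise sums\<close>

lemma I_int_Un:
  assumes "N \<ge> 1"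
  shows "I_left N \<union> I_right N = I_int N" "I_left N \<inter> I_right N = {}"
proof -
  have "1 - 3 * L_end N = 1 - 3 / (2 * real N)" "1 - 3 * R_end N = 1 - 3 / (2 * real N + 2)"
    by (simp_all add: L_end_def R_end_def)
  moreover have "R_end N \<le> L_end N"
    using assms by (simp add: L_end_def R_end_def field_simps)
  then have "1 - 3 * L_end N \<le> 1 - 3/2 * (L_end N + R_end N)"
    "1 - 3/2 * (L_end N + R_end N) \<le> 1 - 3 * R_end N"
    by (simp_all add: field_simps)
  ultimately show "I_left N \<union> I_right N = I_int N"
    unfolding I_left_def I_right_def I_int_def by (simp add: ivl_disj_un_two(3))
  show "I_left N \<inter> I_right N = {}"
    unfolding I_left_def I_right_def by auto
qed

lemma I_int_iff_floor:
  assumes "x < 1" "N \<ge> 1"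
  shows "x \<in> I_int N \<longleftrightarrow> \<lfloor>3 / (2 * (1 - x))\<rfloor> = int N"
proof -
  have "1 - 3 / (2 * real N) \<le> x \<longleftrightarrow> real N \<le> 3 / (2 * (1 - x))"
    using assms by (auto simp: field_simps)
  moreover have "x < 1 - 3 / (2 * real N + 2) \<longleftrightarrow> 3 / (2 * (1 - x)) < real N + 1"
    using assms by (auto simp: field_simps)
  ultimately show ?thesis
    unfolding I_int_def by (simp add: floor_eq_iff)
qed

lemma ex1_I_int:
  assumes "-1/2 \<le> x" "x < 1"
  shows "\<exists>!N. N \<ge> 1 \<and> x \<in> I_int N"
proof -
  have "1 \<le> 3 / (2 * (1 - x))"
    using assms by (simp add: field_simps)
  then have *: "1 \<le> \<lfloor>3 / (2 * (1 - x))\<rfloor>"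
    by (simp only: one_le_floor)
  then obtain n where n: "\<lfloor>3 / (2 * (1 - x))\<rfloor> = int n"
    by (metis nonneg_int_cases order_trans zero_le_one)
  with * have "n \<ge> 1" by linarith
  with n show ?thesis
    using I_int_iff_floor[OF assms(2)] by (metis of_nat_eq_iff)
qed

lemma N_of_eq:
  assumes "N \<ge> 1" "x \<in> I_int N"
  shows "N_of x = N"
proof -
  have "3 / (2 * real N) \<le> 3/2" using assms(1) by (simp add: field_simps)
  then have "-1/2 \<le> x" using assms(2) unfolding I_int_def by auto
  moreover have "x < 1"
  proof -
    have "3 / (2 * real N + 2) > 0" by simp
    moreover have "x < 1 - 3 / (2 * real N + 2)" using assms(2) by (simp add: I_int_def)
    ultimately show ?thesis by linarith
  qed
  ultimately show ?thesis
    unfolding N_of_def using ex1_I_int assms by (intro the1_equality) auto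
qed

lemma countably_additive_add:
  assumes "countably_additive M f" "countably_additive M g"
  shows "countably_additive M (\<lambda>E. f E + (g E :: ennreal))"
  unfolding countably_additive_def
proof (intro allI impI)
  fix A :: "nat \<Rightarrow> 'a set"
  assume "range A \<subseteq> M" "disjoint_family A" "(\<Union>i. A i) \<in> M"
  then have "(\<Sum>i. f (A i)) = f (\<Union>i. A i)" "(\<Sum>i. g (A i)) = g (\<Union>i. A i)"
    using assms unfolding countably_additive_def by blast+
  moreover have "(\<Sum>i. f (A i) + g (A i)) = (\<Sum>i. f (A i)) + (\<Sum>i. g (A i))"
    by (rule suminf_add[symmetric]) (rule summableI)+
  ultimately show "(\<Sum>i. f (A i) + g (A i)) = f (\<Union>i. A i) + g (\<Union>i. A i)"
    by simp
qed

lemma countably_additive_cmult: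
  assumes "countably_additive M f"
  shows "countably_additive M (\<lambda>E. c * (f E :: ennreal))"
  using assms unfolding countably_additive_def by simp

lemma countably_additive_sum:
  assumes "\<And>i. i \<in> I \<Longrightarrow> countably_additive M (f i)"
  shows "countably_additive M (\<lambda>E. \<Sum>i\<in>I. (f i E :: ennreal))"
  using assms
proof (induction I rule: infinite_finite_induct)
  case (insert i I)
  then show ?case
    by (simp add: countably_additive_add)
qed (simp_all add: countably_additive_def)

lemma countably_additive_emeasure_borel:
  assumes "sets M = sets borel"
  shows "countably_additive (sets borel) (emeasure M)"
  using emeasure_countably_additive[of M] assms by simp

lemma sets_borel_measure_of [simp]: "sets (borel_measure_of f) = sets borel"
  unfolding borel_measure_of_def
  using sets.sets_measure_of_eq[of "borel :: (real \<times> real) measure"] by simp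

lemma emeasure_borel_measure_of:
  assumes "E \<in> sets borel" "f {} = 0" "countably_additive (sets borel) f"
  shows "emeasure (borel_measure_of f) E = f E"
  unfolding borel_measure_of_def
proof (rule emeasure_measure_of_sigma)
  show "sigma_algebra UNIV (sets (borel :: (real \<times> real) measure))"
    using sets.sigma_algebra_axioms[of "borel :: (real \<times> real) measure"] by simp
qed (use assms in \<open>simp_all add: positive_def\<close>)

lemma sets_push_leb [simp]: "sets (push_leb F a) = sets borel"
  by (simp add: push_leb_def)

lemma emeasure_nu_left:
  assumes "E \<in> sets borel"
  shows "emeasure (nu_left N x) E =
       (\<Sum>k<N. emeasure (push_leb (A_left N x k) (p_left N x * L_end N)) E)
     + (\<Sum>k<N. ennreal (alpha_wt N k) * emeasure (push_leb (B_left N x k) (real N * v_left N x)) E)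
     + (\<Sum>k<N. ennreal (beta_wt N k) * emeasure (push_leb (C_left N x k) (real N * v_left N x)) E)"
  unfolding nu_left_def using assms
  by (intro emeasure_borel_measure_of countably_additive_add countably_additive_sum
        countably_additive_cmult countably_additive_emeasure_borel sets_push_leb) simp_all

lemma emeasure_nu_right:
  assumes "E \<in> sets borel"
  shows "emeasure (nu_right N x) E =
       (\<Sum>k\<le>N. emeasure (push_leb (A_right N x k) (p_right N x * R_end N)) E)
     + (\<Sum>k<N. ennreal (alpha_wt N k) * emeasure (push_leb (B_right N x k) (real N * v_right N x)) E)
     + (\<Sum>k<N. ennreal (beta_wt N k) * emeasure (push_leb (C_right N x k) (real N * v_right N x)) E)"
  unfolding nu_right_def using assms
  by (intro emeasure_borel_measure_of countably_additive_add countably_additive_sum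
        countably_additive_cmult countably_additive_emeasure_borel sets_push_leb) simp_all

lemma emeasure_pi_meas:
  assumes "E \<in> sets borel"
  shows "emeasure (pi_meas x) E =
    emeasure (nu_meas x) E + emeasure (distr (nu_meas x) borel prod.swap) E"
proof -
  have "sets (nu_meas x) = sets borel"
    by (simp add: nu_meas_def nu_left_def nu_right_def)
  then show ?thesis
    unfolding pi_meas_def using assms
    by (intro emeasure_borel_measure_of countably_additive_add
          countably_additive_emeasure_borel) simp_all
qed

end

theory Submission
  imports Defs
begin

text \<open>Let \<open>(U, V)\<close> be distributed according to a copula. Then \<open>\<rho> = 1 - 6 E (U - V)\<^sup>2\<close> and
  \<open>\<phi> = 1 - 3 E \<bar>U - V\<bar>\<close> (\<open>spearman_rho_eq\<close>, \<open>footrule_eq\<close>). With \<open>m = (1 - x)/3\<close> the problem is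
  to minimize \<open>E (U - V)\<^sup>2\<close> over couplings of two uniform variables with \<open>E \<bar>U - V\<bar> = m\<close>. With
  Lagrange multiplier \<open>2 c\<close> this is the optimal transport problem with cost \<open>(\<bar>u - w\<bar> - c)\<^sup>2\<close>.

  Suppose that a strictly increasing \<open>S : \<real> \<rightarrow> \<real>\<close> satisfies \<open>S (S u) = u + \<theta>\<close>, and put \<open>c = \<theta>/2\<close>. An
  antiderivative \<open>f\<close> of \<open>2 (u + c - S u)\<close> is then a dual potential: the derivative of
  \<open>(w - u - c)\<^sup>2 - f u - f w\<close> in \<open>w\<close> is \<open>2 (S w - S (S u))\<close>, so for fixed \<open>u\<close> the minimum is at
  \<open>w = S u\<close> and nowhere else, and its value is a constant (\<open>excess_gt\<close>, \<open>excess_contact_const\<close>). Hence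
  every coupling concentrated on the set \<open>w = S u \<or> u = S w\<close> is optimal, and all couplings with the same
  \<open>m\<close> and the same value are concentrated there (\<open>contact_minimizes\<close>).

  Uniqueness also follows from \<open>S \<circ> S\<close> being a translation. On the contact set a coupling is given by the
  masses that it puts above and below the diagonal, and the margin conditions determine these recursively along
  the orbits of \<open>S\<close>, which leave \<open>[0,1]\<close> after finitely many steps (\<open>contact_measure_unique\<close>).

  It remains to see that \<open>\<pi>\<^sub>x\<close> has uniform margins, lives on the contact set of such a map, and has the
  asserted moments. The map is piecewise linear: it alternately stretches intervals by \<open>(N + 1)/N\<close>, translates,
  compresses by \<open>N/(N + 1)\<close>, and translates. The segments carrying \<open>\<nu>\<^sub>x\<close> are its graph over these pieces, and
  their shadows tile \<open>[0,1]\<close> (\<open>pi_meas_left\<close>, \<open>pi_meas_right\<close>). The moments are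
  \<open>E \<bar>U - V\<bar> = m\<close> and \<open>E (U - V)\<^sup>2 = m\<^sup>2 - \<Delta>\<^sup>2 + 2/3 \<Delta> v\<close>, with
  \<open>\<Delta> v = \<Delta>\<^bsup>3/2\<^esup> / sqrt (N (N + 1))\<close>.\<close>

section \<open>Couplings of two uniform variables\<close>

lemma borel_measurable_fst_prod [measurable]:
  "fst \<in> borel_measurable (borel :: (real \<times> real) measure)"
  by (intro borel_measurable_continuous_onI continuous_intros)

lemma borel_measurable_snd_prod [measurable]:
  "snd \<in> borel_measurable (borel :: (real \<times> real) measure)"
  by (intro borel_measurable_continuous_onI continuous_intros)

text \<open>Uniformity of the margins is stated for all Borel sets, so that it transfers at once to integrals
  of functions of one coordinate; that the measure is a probability concentrated on the unit square
  is a consequence.\<close>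

locale copula_measure =
  fixes \<mu> :: "(real \<times> real) measure"
  assumes sets_eq [measurable_cong, simp]: "sets \<mu> = sets borel"
    and margin_fst: "E \<in> sets borel \<Longrightarrow> emeasure \<mu> (fst -` E) = emeasure lborel (E \<inter> {0..1})"
    and margin_snd: "E \<in> sets borel \<Longrightarrow> emeasure \<mu> (snd -` E) = emeasure lborel (E \<inter> {0..1})"
begin

lemma space_eq [simp]: "space \<mu> = UNIV"
  using sets_eq_imp_space_eq[OF sets_eq] by simp

sublocale prob_space \<mu>
proof
  show "emeasure \<mu> (space \<mu>) = 1"
    using margin_fst[of UNIV] by simp
qed

lemma AE_unit_square: "AE p in \<mu>. fst p \<in> {0..1} \<and> snd p \<in> {0..1}"
proof -
  have "AE p in \<mu>. fst p \<in> {0..1}"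
  proof (rule AE_I[of _ _ "fst -` (-{0..1})"])
    show "emeasure \<mu> (fst -` (-{0..1})) = 0" by (subst margin_fst) auto
    show "fst -` (- {0..1::real}) \<in> sets \<mu>"
      using measurable_sets[of fst \<mu> borel "- {0..1::real}"] by simp
  qed auto
  moreover have "AE p in \<mu>. snd p \<in> {0..1}"
  proof (rule AE_I[of _ _ "snd -` (-{0..1})"])
    show "emeasure \<mu> (snd -` (-{0..1})) = 0" by (subst margin_snd) auto
    show "snd -` (- {0..1::real}) \<in> sets \<mu>"
      using measurable_sets[of snd \<mu> borel "- {0..1::real}"] by simp
  qed auto
  ultimately show ?thesis by eventually_elim auto
qed

lemma distr_fst: "distr \<mu> borel fst = density lborel (indicator {0..1})"
proof (rule measure_eqI)
  fix E :: "real set" assume "E \<in> sets (distr \<mu> borel fst)"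
  then have E [measurable]: "E \<in> sets borel" by simp
  have "emeasure (distr \<mu> borel fst) E = emeasure \<mu> (fst -` E)"
    using E by (subst emeasure_distr) auto
  also have "\<dots> = emeasure (density lborel (indicator {0..1})) E"
    using E by (simp add: margin_fst emeasure_density indicator_inter_arith[symmetric] Int_commute)
  finally show "emeasure (distr \<mu> borel fst) E = emeasure (density lborel (indicator {0..1})) E" .
qed simp

lemma distr_snd: "distr \<mu> borel snd = density lborel (indicator {0..1})"
proof (rule measure_eqI)
  fix E :: "real set" assume "E \<in> sets (distr \<mu> borel snd)"
  then have E [measurable]: "E \<in> sets borel" by simp
  have "emeasure (distr \<mu> borel snd) E = emeasure \<mu> (snd -` E)"
    using E by (subst emeasure_distr) auto
  also have "\<dots> = emeasure (density lborel (indicator {0..1})) E"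
    using E by (simp add: margin_snd emeasure_density indicator_inter_arith[symmetric] Int_commute)
  finally show "emeasure (distr \<mu> borel snd) E = emeasure (density lborel (indicator {0..1})) E" .
qed simp

lemma margin_integral:
  fixes f :: "real \<Rightarrow> real"
  assumes "continuous_on UNIV f"
  shows "integrable \<mu> (\<lambda>p. f (fst p))" "integrable \<mu> (\<lambda>p. f (snd p))"
    "(\<integral>p. f (fst p) \<partial>\<mu>) = (\<integral>t. f t * indicator {0..1} t \<partial>lborel)"
    "(\<integral>p. f (snd p) \<partial>\<mu>) = (\<integral>t. f t * indicator {0..1} t \<partial>lborel)"
proof -
  have f [measurable]: "f \<in> borel_measurable borel"
    using assms by (rule borel_measurable_continuous_onI)
  have d: "density lborel (indicator {0..1}) = density lborel (\<lambda>t. ennreal (indicator {0..1::real} t))"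
    by (simp add: ennreal_indicator)
  have "continuous_on {0..1} f"
    using assms by (rule continuous_on_subset) simp
  then have "integrable lborel (\<lambda>x. indicator {0..1} x *\<^sub>R f x)"
    by (intro borel_integrable_compact) auto
  then have i: "integrable (density lborel (indicator {0..1})) f"
    unfolding d by (subst integrable_density) auto
  have v: "integral\<^sup>L (density lborel (indicator {0..1})) f = (\<integral>t. f t * indicator {0..1} t \<partial>lborel)"
    unfolding d by (subst integral_density) (auto simp: mult.commute)
  show "integrable \<mu> (\<lambda>p. f (fst p))" "integrable \<mu> (\<lambda>p. f (snd p))"
    using i integrable_distr_eq[of fst \<mu> borel f] integrable_distr_eq[of snd \<mu> borel f]
    by (simp_all add: distr_fst distr_snd)
  show "(\<integral>p. f (fst p) \<partial>\<mu>) = (\<integral>t. f t * indicator {0..1} t \<partial>lborel)"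
    "(\<integral>p. f (snd p) \<partial>\<mu>) = (\<integral>t. f t * indicator {0..1} t \<partial>lborel)"
    using v integral_distr[of fst \<mu> borel f] integral_distr[of snd \<mu> borel f]
    by (simp_all add: distr_fst distr_snd)
qed

lemma moments:
  "(\<integral>p. fst p \<partial>\<mu>) = 1 / 2" "(\<integral>p. snd p \<partial>\<mu>) = 1 / 2"
  "(\<integral>p. (fst p)\<^sup>2 \<partial>\<mu>) = 1 / 3" "(\<integral>p. (snd p)\<^sup>2 \<partial>\<mu>) = 1 / 3"
proof -
  have "(\<integral>t. t ^ k * indicator {0..1} t \<partial>lborel) = 1 / (real k + 1)" for k
    using integral_power[of 0 1 k] by (simp add: add.commute)
  from this[of 1] this[of 2] show "(\<integral>p. fst p \<partial>\<mu>) = 1 / 2" "(\<integral>p. snd p \<partial>\<mu>) = 1 / 2"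
    "(\<integral>p. (fst p)\<^sup>2 \<partial>\<mu>) = 1 / 3" "(\<integral>p. (snd p)\<^sup>2 \<partial>\<mu>) = 1 / 3"
    using margin_integral(3,4)[of "\<lambda>t. t"] margin_integral(3,4)[of "\<lambda>t. t\<^sup>2"]
    by (simp_all add: continuous_intros)
qed

lemma integrable_continuous:
  fixes f :: "real \<times> real \<Rightarrow> real"
  assumes "continuous_on UNIV f"
  shows "integrable \<mu> f"
proof -
  have "compact (f ` ({0..1} \<times> {0..1}))"
    using assms by (intro compact_continuous_image compact_Times)
      (auto intro: continuous_on_subset)
  then obtain B where B: "\<And>p. p \<in> {0..1} \<times> {0..1} \<Longrightarrow> norm (f p) \<le> B"
    using compact_imp_bounded[of "f ` ({0..1} \<times> {0..1})"] by (auto simp: bounded_iff)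
  show ?thesis
  proof (rule integrable_const_bound[of _ B])
    show "AE p in \<mu>. norm (f p) \<le> B"
      using AE_unit_square by eventually_elim (rule B, auto simp: mem_Times_iff)
    show "f \<in> borel_measurable \<mu>"
      using borel_measurable_continuous_onI[OF assms] by simp
  qed
qed

text \<open>Both functionals integrate a distribution function \<open>C u v\<close>, that is, the measure of a
  section of a set in a product space. Exchanging the two integrations turns them into expectations
  of the measure of the opposite section.\<close>

lemma Fubini_indicator:
  fixes M :: "'a measure" and T :: "('a \<times> real \<times> real) set"
  assumes "sigma_finite_measure M" and T: "T \<in> sets (M \<Otimes>\<^sub>M \<mu>)"
    and sub: "T \<subseteq> A \<times> UNIV" and A: "A \<in> sets M" "emeasure M A < \<infinity>"
  shows "(\<integral>z. measure \<mu> (Pair z -` T) \<partial>M) = (\<integral>p. measure M ((\<lambda>z. (z, p)) -` T) \<partial>\<mu>)"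
proof -
  have Times: "emeasure (M \<Otimes>\<^sub>M \<mu>) (A \<times> UNIV) = emeasure M A"
    using A emeasure_pair_measure_Times[of A M UNIV] emeasure_space_1 by simp
  interpret M: sigma_finite_measure M by fact
  interpret pair_sigma_finite M \<mu> ..
  have "emeasure (M \<Otimes>\<^sub>M \<mu>) T \<le> emeasure (M \<Otimes>\<^sub>M \<mu>) (A \<times> UNIV)"
    using sub A T sets.top[of \<mu>] by (intro emeasure_mono) auto
  also have "\<dots> = emeasure M A"
    by (rule Times)
  finally have fin: "emeasure (M \<Otimes>\<^sub>M \<mu>) T < \<infinity>" using A by simp
  have "integrable (M \<Otimes>\<^sub>M \<mu>) (case_prod (\<lambda>z p. indicator T (z, p) :: real))"
    using T fin by (simp add: case_prod_unfold)
  from Fubini_integral[OF this]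
  have "(\<integral>p. \<integral>z. indicator T (z, p) \<partial>M \<partial>\<mu>) = (\<integral>z. \<integral>p. indicator T (z, p) \<partial>\<mu> \<partial>M :: real)" .
  moreover have "(\<integral>z. indicator T (z, p) \<partial>M :: real) = measure M ((\<lambda>z. (z, p)) -` T)" for p
  proof -
    have "(\<lambda>z. (z, p)) -` T \<in> sets M" using T by (rule sets_Pair2)
    moreover have "(\<lambda>z. indicator T (z, p) :: real) = indicator ((\<lambda>z. (z, p)) -` T)"
      by (auto simp: indicator_def)
    ultimately show ?thesis
      using sets.sets_into_space[of "(\<lambda>z. (z, p)) -` T" M] by (simp add: Int_absorb2)
  qed
  moreover have "(\<integral>p. indicator T (z, p) \<partial>\<mu> :: real) = measure \<mu> (Pair z -` T)" for z
  proof -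
    have "Pair z -` T \<in> sets \<mu>" using T by (rule sets_Pair1)
    moreover have "(\<lambda>p. indicator T (z, p) :: real) = indicator (Pair z -` T)"
      by (auto simp: indicator_def)
    ultimately show ?thesis by simp
  qed
  ultimately show ?thesis by simp
qed

text \<open>By Fubini \<open>\<integral>C = E (1 - U) (1 - V)\<close>, and \<open>2 U V = U\<^sup>2 + V\<^sup>2 - (U - V)\<^sup>2\<close> where \<open>U\<close>, \<open>V\<close> have
  second moment \<open>1/3\<close>.\<close>

lemma spearman_rho_eq:
  assumes C: "\<And>u v. u \<in> {0..1} \<Longrightarrow> v \<in> {0..1} \<Longrightarrow> C u v = measure \<mu> ({0..u} \<times> {0..v})"
  shows "spearman_rho C = 1 - 6 * (\<integral>p. (fst p - snd p)\<^sup>2 \<partial>\<mu>)"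
proof -
  define Q where "Q = {0..1::real} \<times> {0..1::real}"
  define T where "T = {w \<in> space (lborel \<Otimes>\<^sub>M \<mu>). fst w \<in> Q \<and>
      0 \<le> fst (snd w) \<and> fst (snd w) \<le> fst (fst w) \<and> 0 \<le> snd (snd w) \<and> snd (snd w) \<le> snd (fst w)}"
  have Q [measurable]: "Q \<in> sets borel"
    unfolding Q_def by (intro borel_closed closed_Times) auto
  have T: "T \<in> sets (lborel \<Otimes>\<^sub>M \<mu>)"
    unfolding T_def by measurable
  have eQ: "emeasure lborel Q < \<infinity>"
    unfolding Q_def by (simp add: lborel_prod[symmetric] lborel.emeasure_pair_measure_Times)
  have "(LINT z:Q|lborel. C (fst z) (snd z)) = (\<integral>z. measure \<mu> (Pair z -` T) \<partial>lborel)"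
    unfolding set_lebesgue_integral_def
  proof (rule Bochner_Integration.integral_cong)
    fix z :: "real \<times> real"
    show "indicator Q z *\<^sub>R C (fst z) (snd z) = measure \<mu> (Pair z -` T)"
    proof (cases "z \<in> Q")
      case True
      then have "Pair z -` T = {0..fst z} \<times> {0..snd z}"
        by (auto simp: T_def space_pair_measure)
      with True show ?thesis by (auto simp: C Q_def)
    next
      case False
      then have "Pair z -` T = {}" by (auto simp: T_def)
      with False show ?thesis by simp
    qed
  qed simp
  also have "\<dots> = (\<integral>p. measure lborel ((\<lambda>z. (z, p)) -` T) \<partial>\<mu>)"
    by (rule Fubini_indicator[OF _ T, of Q]) (use eQ in \<open>auto simp: T_def sigma_finite_lborel\<close>)
  also have "\<dots> = (\<integral>p. (1 - fst p) * (1 - snd p) \<partial>\<mu>)"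
  proof (rule integral_cong_AE)
    show "AE p in \<mu>. measure lborel ((\<lambda>z. (z, p)) -` T) = (1 - fst p) * (1 - snd p)"
      using AE_unit_square
    proof eventually_elim
      case (elim p)
      then have "(\<lambda>z. (z, p)) -` T = {fst p..1} \<times> {snd p..1}"
        by (auto simp: T_def space_pair_measure Q_def)
      then show ?case using elim
        by (simp add: measure_def lborel_prod[symmetric] lborel.emeasure_pair_measure_Times
            ennreal_mult[symmetric])
    qed
    show "(\<lambda>p. measure lborel ((\<lambda>z. (z, p)) -` T)) \<in> borel_measurable \<mu>"
    proof -
      interpret pair_sigma_finite lborel \<mu> ..
      show ?thesis unfolding measure_def using measurable_emeasure_Pair2[OF T] by measurable
    qed
  qed measurable
  also have "\<dots> = (\<integral>p. 1 - fst p - snd p + ((fst p)\<^sup>2 / 2 + (snd p)\<^sup>2 / 2 - (fst p - snd p)\<^sup>2 / 2) \<partial>\<mu>)"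
    by (rule Bochner_Integration.integral_cong) (auto simp: power2_eq_square field_simps)
  also have "\<dots> = 1 - 1/2 - 1/2 + (1/3/2 + 1/3/2 - (\<integral>p. (fst p - snd p)\<^sup>2 \<partial>\<mu>) / 2)"
    by (simp add: moments integrable_continuous continuous_intros prob_space[simplified])
  finally show ?thesis unfolding spearman_rho_def Q_def by simp
qed

text \<open>By Fubini \<open>\<integral>C t t dt = E (1 - max U V)\<close>, and \<open>2 max U V = U + V + \<bar>U - V\<bar>\<close>.\<close>

lemma footrule_eq:
  assumes C: "\<And>u v. u \<in> {0..1} \<Longrightarrow> v \<in> {0..1} \<Longrightarrow> C u v = measure \<mu> ({0..u} \<times> {0..v})"
  shows "footrule C = 1 - 3 * (\<integral>p. \<bar>fst p - snd p\<bar> \<partial>\<mu>)"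
proof -
  define T where "T = {w \<in> space (lborel \<Otimes>\<^sub>M \<mu>). fst w \<in> {0..1} \<and>
      0 \<le> fst (snd w) \<and> fst (snd w) \<le> fst w \<and> 0 \<le> snd (snd w) \<and> snd (snd w) \<le> fst w}"
  have T: "T \<in> sets (lborel \<Otimes>\<^sub>M \<mu>)"
    unfolding T_def by measurable
  have "(LINT t:{0..1}|lborel. C t t) = (\<integral>t. measure \<mu> (Pair t -` T) \<partial>lborel)"
    unfolding set_lebesgue_integral_def
  proof (rule Bochner_Integration.integral_cong)
    fix t :: real
    show "indicator {0..1} t *\<^sub>R C t t = measure \<mu> (Pair t -` T)"
    proof (cases "t \<in> {0..1}")
      case True
      then have "Pair t -` T = {0..t} \<times> {0..t}"
        by (auto simp: T_def space_pair_measure)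
      with True show ?thesis by (auto simp: C)
    next
      case False
      then have "Pair t -` T = {}" by (auto simp: T_def)
      with False show ?thesis by simp
    qed
  qed simp
  also have "\<dots> = (\<integral>p. measure lborel ((\<lambda>t. (t, p)) -` T) \<partial>\<mu>)"
    by (rule Fubini_indicator[OF _ T, of "{0..1}"]) (auto simp: T_def sigma_finite_lborel)
  also have "\<dots> = (\<integral>p. 1 - (fst p / 2 + snd p / 2 + \<bar>fst p - snd p\<bar> / 2) \<partial>\<mu>)"
  proof (rule integral_cong_AE)
    show "AE p in \<mu>. measure lborel ((\<lambda>t. (t, p)) -` T) = 1 - (fst p / 2 + snd p / 2 + \<bar>fst p - snd p\<bar> / 2)"
      using AE_unit_square
    proof eventually_elim
      case (elim p)
      then have "(\<lambda>t. (t, p)) -` T = {max (fst p) (snd p)..1}"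
        by (auto simp: T_def space_pair_measure)
      then show ?case using elim by (auto simp: max_def field_simps)
    qed
    show "(\<lambda>p. measure lborel ((\<lambda>t. (t, p)) -` T)) \<in> borel_measurable \<mu>"
    proof -
      interpret pair_sigma_finite lborel \<mu> ..
      show ?thesis unfolding measure_def using measurable_emeasure_Pair2[OF T] by measurable
    qed
  qed measurable
  also have "\<dots> = 1 - (1/2/2 + 1/2/2 + (\<integral>p. \<bar>fst p - snd p\<bar> \<partial>\<mu>) / 2)"
    by (simp add: moments integrable_continuous continuous_intros prob_space[simplified])
  finally show ?thesis unfolding footrule_def by simp
qed

end

text \<open>A copula prescribes its measure only on boxes anchored at the origin. Uniform margins on the boxes
  \<open>[0,u] \<times> [0,1]\<close> determine the distribution functions of both coordinates, hence the two margins.\<close>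

lemma is_copula_iff:
  "is_copula C \<longleftrightarrow>
    (\<exists>\<mu>. copula_measure \<mu> \<and> (\<forall>u\<in>{0..1}. \<forall>v\<in>{0..1}. C u v = measure \<mu> ({0..u} \<times> {0..v})))"
proof
  assume "is_copula C"
  then obtain \<mu> :: "(real \<times> real) measure" where p: "prob_space \<mu>" and s: "sets \<mu> = sets borel"
    and sq: "measure \<mu> ({0..1} \<times> {0..1}) = 1"
    and C: "\<And>u v. u \<in> {0..1} \<Longrightarrow> v \<in> {0..1} \<Longrightarrow> C u v = measure \<mu> ({0..u} \<times> {0..v})"
    and C1: "\<And>u. u \<in> {0..1} \<Longrightarrow> C u 1 = u" "\<And>v. v \<in> {0..1} \<Longrightarrow> C 1 v = v"
    unfolding is_copula_def by blast
  interpret prob_space \<mu> by fact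
  note s [measurable_cong, simp]
  have sp [simp]: "space \<mu> = UNIV" using sets_eq_imp_space_eq[OF s] by simp
  have box: "{a..b} \<times> {c..d} \<in> sets \<mu>" for a b c d :: real
    by (simp add: borel_closed closed_Times)
  have AE: "AE p in \<mu>. p \<in> {0..1} \<times> {0..1}"
    using sq prob_eq_1[OF box] by blast
  have uniform: "distr \<mu> borel f = density lborel (indicator {0..1})"
    if f [measurable]: "f \<in> borel_measurable \<mu>"
      and cdf: "\<And>t. t \<in> {0..1} \<Longrightarrow> prob {p. f p \<le> t} = t"
      and AE_f: "AE p in \<mu>. f p \<in> {0..1}" for f :: "real \<times> real \<Rightarrow> real"
  proof (rule cdf_unique)
    show "real_distribution (distr \<mu> borel f)"
      by (intro real_distribution.intro real_distribution_axioms.intro prob_space_distr) auto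
    have "emeasure (density lborel (indicator {0..1})) (UNIV :: real set) = 1"
      by (subst emeasure_density) (auto simp: nn_integral_indicator)
    then show "real_distribution (density lborel (indicator {0..1}))"
      by (intro real_distribution.intro real_distribution_axioms.intro prob_spaceI) auto
    show "cdf (distr \<mu> borel f) = cdf (density lborel (indicator {0..1}))"
    proof
      fix t :: real
      have "cdf (distr \<mu> borel f) t = prob {p. f p \<le> t}"
        unfolding cdf_def by (subst measure_distr) (auto simp: vimage_def)
      also have "\<dots> = min 1 (max 0 t)"
      proof -
        consider "t < 0" | "t \<in> {0..1}" | "t > 1" by fastforce
        then show ?thesis
        proof cases
          case 1
          have "prob {p. f p \<le> t} = 0"
          proof -
            have "AE p in \<mu>. \<not> f p \<le> t" using AE_f by eventually_elim (use 1 in auto)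
            moreover have "{p. f p \<le> t} \<in> sets \<mu>"
              using f measurable_sets[of f \<mu> borel "{..t}"] by (simp add: vimage_def)
            ultimately show ?thesis by (subst prob_eq_0) auto
          qed
          with 1 show ?thesis by simp
        next
          case 2
          then show ?thesis by (simp add: cdf)
        next
          case 3
          have "prob {p. f p \<le> t} = 1"
          proof -
            have "AE p in \<mu>. f p \<le> t" using AE_f by eventually_elim (use 3 in auto)
            moreover have "{p. f p \<le> t} \<in> sets \<mu>"
              using f measurable_sets[of f \<mu> borel "{..t}"] by (simp add: vimage_def)
            ultimately show ?thesis by (subst prob_eq_1) auto
          qed
          with 3 show ?thesis by simp
        qed
      qed
      also have "\<dots> = cdf (density lborel (indicator {0..1})) t"
      proof -
        have "emeasure (density lborel (indicator {0..1})) {..t} = emeasure lborel ({..t} \<inter> {0..1})"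
          by (simp add: emeasure_density indicator_inter_arith[symmetric] Int_commute)
        moreover have "{..t} \<inter> {0..1} = {0..min 1 t}" by auto
        ultimately show ?thesis by (simp add: cdf_def measure_def min_def max_def)
      qed
      finally show "cdf (distr \<mu> borel f) t = cdf (density lborel (indicator {0..1})) t" .
    qed
  qed
  have half: "prob {p. fst p \<le> t} = t" "prob {p. snd p \<le> t} = t" if "t \<in> {0..1}" for t
  proof -
    have "prob {p. fst p \<le> t} = prob ({0..t} \<times> {0..1})"
    proof (rule measure_eq_AE)
      show "AE p in \<mu>. p \<in> {p. fst p \<le> t} \<longleftrightarrow> p \<in> {0..t} \<times> {0..1}"
        using AE by eventually_elim auto
      show "{p. fst p \<le> t} \<in> sets \<mu>"
        using measurable_sets[of fst \<mu> borel "{..t}"] by (simp add: vimage_def)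
    qed (rule box)
    then show "prob {p. fst p \<le> t} = t" using that C[of t 1] C1 by simp
    have "prob {p. snd p \<le> t} = prob ({0..1} \<times> {0..t})"
    proof (rule measure_eq_AE)
      show "AE p in \<mu>. p \<in> {p. snd p \<le> t} \<longleftrightarrow> p \<in> {0..1} \<times> {0..t}"
        using AE by eventually_elim auto
      show "{p. snd p \<le> t} \<in> sets \<mu>"
        using measurable_sets[of snd \<mu> borel "{..t}"] by (simp add: vimage_def)
    qed (rule box)
    then show "prob {p. snd p \<le> t} = t" using that C[of 1 t] C1 by simp
  qed
  have emb: "emeasure \<mu> (f -` E) = emeasure lborel (E \<inter> {0..1})"
    if "distr \<mu> borel f = density lborel (indicator {0..1})" "f \<in> borel_measurable \<mu>"
      and E: "E \<in> sets borel" for f :: "real \<times> real \<Rightarrow> real" and E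
  proof -
    have "emeasure \<mu> (f -` E) = emeasure (distr \<mu> borel f) E"
      using that by (subst emeasure_distr) auto
    also have "\<dots> = emeasure lborel (E \<inter> {0..1})"
      using E that(1) by (simp add: emeasure_density indicator_inter_arith[symmetric] Int_commute)
    finally show ?thesis .
  qed
  have "copula_measure \<mu>"
  proof
    show "emeasure \<mu> (fst -` E) = emeasure lborel (E \<inter> {0..1})" if "E \<in> sets borel" for E
    proof (rule emb[OF uniform])
      show "AE p in \<mu>. fst p \<in> {0..1}" using AE by eventually_elim auto
    qed (use that half in auto)
    show "emeasure \<mu> (snd -` E) = emeasure lborel (E \<inter> {0..1})" if "E \<in> sets borel" for E
    proof (rule emb[OF uniform])
      show "AE p in \<mu>. snd p \<in> {0..1}" using AE by eventually_elim auto
    qed (use that half in auto)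
  qed simp
  with C show "\<exists>\<mu>. copula_measure \<mu> \<and> (\<forall>u\<in>{0..1}. \<forall>v\<in>{0..1}. C u v = measure \<mu> ({0..u} \<times> {0..v}))"
    by blast
next
  assume "\<exists>\<mu>. copula_measure \<mu> \<and> (\<forall>u\<in>{0..1}. \<forall>v\<in>{0..1}. C u v = measure \<mu> ({0..u} \<times> {0..v}))"
  then obtain \<mu> where cm: "copula_measure \<mu>"
    and C: "\<And>u v. u \<in> {0..1} \<Longrightarrow> v \<in> {0..1} \<Longrightarrow> C u v = measure \<mu> ({0..u} \<times> {0..v})" by blast
  interpret copula_measure \<mu> by fact
  have box: "{a..b} \<times> {c..d} \<in> sets \<mu>" for a b c d :: real
    by (simp add: borel_closed closed_Times)
  have AE: "AE p in \<mu>. p \<in> {0..1} \<times> {0..1}"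
    using AE_unit_square by eventually_elim (auto simp: mem_Times_iff)
  have "measure \<mu> ({0..u} \<times> {0..1}) = u" "measure \<mu> ({0..1} \<times> {0..u}) = u" if "u \<in> {0..1}" for u
  proof -
    have "emeasure \<mu> ({0..u} \<times> {0..1}) = emeasure \<mu> (fst -` {0..u})"
    proof (rule emeasure_eq_AE)
      show "AE p in \<mu>. p \<in> {0..u} \<times> {0..1} \<longleftrightarrow> p \<in> fst -` {0..u}"
        using AE by eventually_elim auto
      show "fst -` {0..u} \<in> sets \<mu>" using measurable_sets[of fst \<mu> borel "{0..u}"] by simp
    qed (rule box)
    then show "measure \<mu> ({0..u} \<times> {0..1}) = u"
      using that by (simp add: margin_fst measure_def)
    have "emeasure \<mu> ({0..1} \<times> {0..u}) = emeasure \<mu> (snd -` {0..u})"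
    proof (rule emeasure_eq_AE)
      show "AE p in \<mu>. p \<in> {0..1} \<times> {0..u} \<longleftrightarrow> p \<in> snd -` {0..u}"
        using AE by eventually_elim auto
      show "snd -` {0..u} \<in> sets \<mu>" using measurable_sets[of snd \<mu> borel "{0..u}"] by simp
    qed (rule box)
    then show "measure \<mu> ({0..1} \<times> {0..u}) = u"
      using that by (simp add: margin_snd measure_def)
  qed
  moreover have "measure \<mu> ({0..1} \<times> {0..1}) = 1"
    using AE prob_eq_1[OF box] by blast
  moreover have "prob_space \<mu>" by (rule prob_space_axioms)
  ultimately show "is_copula C"
    unfolding is_copula_def using C by auto
qed

section \<open>Dual potentials from half shifts\<close>

text \<open>The map \<open>S\<close> is a square root of the translation by \<open>\<theta>\<close>. The plans that turn out to be optimal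
  live on its graph and the mirror image of that graph; duality and uniqueness rest on these
  properties alone.\<close>

locale half_shift =
  fixes S :: "real \<Rightarrow> real" and \<theta> :: real
  assumes period_pos: "\<theta> > 0"
    and strict_mono_S: "strict_mono S"
    and S_S: "S (S u) = u + \<theta>"
begin

lemma S_less_iff [simp]: "S u < S w \<longleftrightarrow> u < w"
  using strict_mono_S by (rule strict_mono_less)

lemma S_le_iff [simp]: "S u \<le> S w \<longleftrightarrow> u \<le> w"
  using strict_mono_S by (rule strict_mono_less_eq)

lemma less_S: "u < S u"
proof (rule ccontr)
  assume "\<not> u < S u"
  then have "S u \<le> u" by simp
  then have "S (S u) \<le> S u" by simp
  with \<open>S u \<le> u\<close> period_pos show False by (simp add: S_S)
qed

text \<open>Surjectivity comes from \<open>S \<circ> S\<close>, and a monotone surjection of the line has no jumps.\<close>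

lemma surj_S: "\<exists>u. S u = w"
  using S_S[of "w - \<theta>"] by (intro exI[of _ "S (w - \<theta>)"]) simp

lemma isCont_S: "isCont S u"
proof -
  have "\<exists>d>0. \<forall>w. \<bar>w - u\<bar> < d \<longrightarrow> \<bar>S w - S u\<bar> < e" if e: "e > 0" for e
  proof -
    obtain a where a: "S a = S u - e" using surj_S by blast
    obtain b where b: "S b = S u + e" using surj_S by blast
    have "S a < S u" "S u < S b" using a b e by auto
    then have "a < u" "u < b" by auto
    have "\<bar>S w - S u\<bar> < e" if "\<bar>w - u\<bar> < min (u - a) (b - u)" for w
    proof -
      from that have "a < w" "w < b" by auto
      then have "S a < S w" "S w < S b" by auto
      with a b show ?thesis by linarith
    qed
    with \<open>a < u\<close> \<open>u < b\<close> show ?thesis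
      by (intro exI[of _ "min (u - a) (b - u)"]) auto
  qed
  then show ?thesis
    by (simp add: continuous_at_eps_delta dist_real_def)
qed

lemma borel_measurable_S [measurable]: "S \<in> borel_measurable borel"
  by (intro borel_measurable_continuous_onI continuous_at_imp_continuous_on) (simp add: isCont_S)

text \<open>If a dual potential \<open>f\<close> satisfies \<open>f u + f w \<le> (w - u - \<theta>/2)\<^sup>2 - const\<close> with equality at \<open>w = S u\<close>, the first order
  condition in \<open>u\<close> forces \<open>f' u = 2 (u + \<theta>/2 - S u)\<close>. The condition in \<open>w\<close> reads
  \<open>f' (S u) = 2 (S u - u - \<theta>/2)\<close>, and the two agree exactly because \<open>S (S u) = u + \<theta>\<close>.\<close>

definition potential :: "real \<Rightarrow> real" where
  "potential = (SOME f. \<forall>u. (f has_real_derivative 2 * (u + \<theta> / 2 - S u)) (at u))"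

lemma potential_deriv: "(potential has_real_derivative 2 * (u + \<theta> / 2 - S u)) (at u)"
proof -
  have "\<exists>f. \<forall>u::real. -\<infinity> < ereal u \<longrightarrow> ereal u < \<infinity> \<longrightarrow>
          (f has_vector_derivative 2 * (u + \<theta> / 2 - S u)) (at u)"
    using isCont_S by (intro einterval_antiderivative) auto
  then have "\<exists>f. \<forall>u. (f has_real_derivative 2 * (u + \<theta> / 2 - S u)) (at u)"
    by (simp add: has_real_derivative_iff_has_vector_derivative)
  from someI_ex[OF this] show ?thesis unfolding potential_def by blast
qed

definition excess :: "real \<Rightarrow> real \<Rightarrow> real" where
  "excess u w = (w - u - \<theta> / 2)\<^sup>2 - potential u - potential w"

lemma excess_deriv:
  "((\<lambda>w. excess u w) has_real_derivative 2 * (S w - S (S u))) (at w)"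
  unfolding excess_def S_S
  by (rule derivative_eq_intros potential_deriv refl | simp add: algebra_simps)+

text \<open>The derivative \<open>2 (S w - S (S u))\<close> has the sign of \<open>w - S u\<close>, so \<open>w = S u\<close> is the only
  minimizer.\<close>

lemma excess_gt:
  assumes "w \<noteq> S u"
  shows "excess u (S u) < excess u w"
proof (cases "w < S u")
  case True
  show ?thesis
  proof (rule DERIV_neg_imp_decreasing_open[OF True])
    show "\<exists>y. ((\<lambda>w. excess u w) has_real_derivative y) (at t) \<and> y < 0" if "w < t" "t < S u" for t
      using that excess_deriv[of u t] by (intro exI[of _ "2 * (S t - S (S u))"]) simp
    show "continuous_on {w..S u} (excess u)"
      by (intro continuous_at_imp_continuous_on ballI) (rule DERIV_isCont[OF excess_deriv])
  qed
next
  case False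
  with assms have gt: "S u < w" by simp
  show ?thesis
  proof (rule DERIV_pos_imp_increasing_open[OF gt])
    show "\<exists>y. ((\<lambda>w. excess u w) has_real_derivative y) (at t) \<and> y > 0" if "S u < t" "t < w" for t
      using that excess_deriv[of u t] by (intro exI[of _ "2 * (S t - S (S u))"]) simp
    show "continuous_on {S u..w} (excess u)"
      by (intro continuous_at_imp_continuous_on ballI) (rule DERIV_isCont[OF excess_deriv])
  qed
qed

text \<open>Let \<open>e u\<close> be the minimal excess over \<open>w\<close>. The excess at \<open>(u, S u')\<close> is an upper bound for
  \<open>e u\<close>, and it exceeds \<open>e u'\<close> by at most \<open>2 \<bar>u - u'\<bar> \<bar>S u - S u'\<bar>\<close>, which is
  \<open>o(\<bar>u - u'\<bar>)\<close> by continuity of \<open>S\<close>. So \<open>e\<close> has derivative zero. The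
  chain rule would not give this, as \<open>S\<close> need not be differentiable.\<close>

lemma excess_contact_const: "excess u (S u) = excess 0 (S 0)"
proof -
  define e where "e = (\<lambda>u. excess u (S u))"
  have first: "((\<lambda>u. excess u w) has_real_derivative 2 * (S u - w)) (at u)" for w u
    unfolding excess_def
    by (rule derivative_eq_intros potential_deriv refl | simp add: algebra_simps)+
  have min1: "e u \<le> excess u w" for u w
    using excess_gt[of w u] by (cases "w = S u") (auto simp: e_def)
  \<comment> \<open>The mean value theorem in the first argument; the derivative vanishes at \<open>u'\<close>.\<close>
  have step: "excess u (S u') - e u' \<le> 2 * \<bar>u - u'\<bar> * \<bar>S u - S u'\<bar>" for u u'
  proof (cases "u = u'")
    case False
    have "\<exists>r. min u u' \<le> r \<and> r \<le> max u u' \<and>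
            excess u (S u') - excess u' (S u') = (u - u') * (2 * (S r - S u'))"
    proof (cases "u < u'")
      case True
      from MVT2[OF _ first[of "S u'"], of u u'] True obtain r where "u < r" "r < u'"
        "excess u' (S u') - excess u (S u') = (u' - u) * (2 * (S r - S u'))" by blast
      then show ?thesis by (intro exI[of _ r]) (auto simp: algebra_simps)
    next
      case f: False
      with False have "u' < u" by simp
      from MVT2[OF _ first[of "S u'"], of u' u] \<open>u' < u\<close> obtain r where "u' < r" "r < u"
        "excess u (S u') - excess u' (S u') = (u - u') * (2 * (S r - S u'))" by blast
      then show ?thesis by (intro exI[of _ r]) (auto simp: algebra_simps)
    qed
    then obtain r where r: "min u u' \<le> r" "r \<le> max u u'"
      "excess u (S u') - e u' = (u - u') * (2 * (S r - S u'))" by (auto simp: e_def)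
    have "\<bar>S r - S u'\<bar> \<le> \<bar>S u - S u'\<bar>"
    proof (cases "u < u'")
      case True
      with r have "S u \<le> S r" "S r \<le> S u'" by auto
      then show ?thesis by linarith
    next
      case False
      with r have "S u' \<le> S r" "S r \<le> S u" by auto
      then show ?thesis by linarith
    qed
    then have "\<bar>u - u'\<bar> * (2 * \<bar>S r - S u'\<bar>) \<le> \<bar>u - u'\<bar> * (2 * \<bar>S u - S u'\<bar>)"
      by (intro mult_left_mono) auto
    moreover have "(u - u') * (2 * (S r - S u')) \<le> \<bar>(u - u') * (2 * (S r - S u'))\<bar>"
      by simp
    moreover have "\<bar>(u - u') * (2 * (S r - S u'))\<bar> = \<bar>u - u'\<bar> * (2 * \<bar>S r - S u'\<bar>)"
      by (simp only: abs_mult abs_numeral)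
    ultimately show ?thesis using r(3) by linarith
  qed (simp add: e_def)
  have le: "\<bar>e u - e u'\<bar> \<le> 2 * \<bar>u - u'\<bar> * \<bar>S u - S u'\<bar>" for u u'
    using step[of u u'] step[of u' u] min1[of u "S u'"] min1[of u' "S u"]
    by (simp add: abs_minus_commute)
  have "(e has_real_derivative 0) (at u)" for u
    unfolding has_field_derivative_def
  proof (subst has_derivative_at2, intro conjI)
    show "bounded_linear ((*) (0::real))" by (simp add: bounded_linear_mult_right)
    have "((\<lambda>y. 2 * \<bar>S y - S u\<bar>) \<longlongrightarrow> 2 * \<bar>S u - S u\<bar>) (at u)"
      using isCont_S[of u] unfolding isCont_def by (intro tendsto_intros)
    then have lim: "((\<lambda>y. 2 * \<bar>S y - S u\<bar>) \<longlongrightarrow> 0) (at u)" by simp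
    show "((\<lambda>y. (1 / norm (y - u)) *\<^sub>R (e y - (e u + 0 * (y - u)))) \<longlongrightarrow> 0) (at u)"
    proof (rule Lim_null_comparison[OF _ lim])
      show "\<forall>\<^sub>F y in at u. norm ((1 / norm (y - u)) *\<^sub>R (e y - (e u + 0 * (y - u)))) \<le> 2 * \<bar>S y - S u\<bar>"
        using eventually_neq_at_within[of u u UNIV]
      proof eventually_elim
        case (elim y)
        then show ?case using le[of y u] by (simp add: field_simps)
      qed
    qed
  qed
  then have "e u = e 0" by (intro DERIV_isconst_all) auto
  then show ?thesis by (simp add: e_def)
qed

definition gap :: real where "gap = excess 0 (S 0)"

definition contact :: "(real \<times> real) set" where
  "contact = {p. snd p = S (fst p) \<or> fst p = S (snd p)}"

lemma contact_sets [measurable]: "contact \<in> sets borel"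
proof -
  have "contact = {p \<in> space (borel \<Otimes>\<^sub>M borel). snd p = S (fst p) \<or> fst p = S (snd p)}"
    by (auto simp: contact_def space_pair_measure)
  also have "\<dots> \<in> sets (borel \<Otimes>\<^sub>M borel)" by measurable
  finally show ?thesis unfolding borel_prod .
qed

text \<open>Replacing \<open>w - u\<close> by \<open>\<bar>u - w\<bar>\<close> only costs a reflection, since \<open>S u > u\<close> keeps the
  contact points of the two halves of the plane apart.\<close>

lemma cost_ge:
  "gap + potential u + potential w \<le> (\<bar>u - w\<bar> - \<theta> / 2)\<^sup>2"
  and cost_eq_iff:
  "(\<bar>u - w\<bar> - \<theta> / 2)\<^sup>2 = gap + potential u + potential w \<longleftrightarrow> (u, w) \<in> contact"
proof -
  have ge: "gap + potential u + potential w \<le> (\<bar>u - w\<bar> - \<theta> / 2)\<^sup>2 \<and>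
     ((\<bar>u - w\<bar> - \<theta> / 2)\<^sup>2 = gap + potential u + potential w \<longleftrightarrow> w = S u)" if "u \<le> w" for u w
  proof -
    have "gap \<le> excess u w" "excess u w = gap \<longleftrightarrow> w = S u"
      using excess_gt[of w u] excess_contact_const[of u]
      by (cases "w = S u"; simp add: gap_def)+
    moreover have "\<bar>u - w\<bar> = w - u" using that by simp
    ultimately show ?thesis by (auto simp: excess_def)
  qed
  show "gap + potential u + potential w \<le> (\<bar>u - w\<bar> - \<theta> / 2)\<^sup>2"
    using ge[of u w] ge[of w u] by (cases "u \<le> w") (auto simp: abs_minus_commute algebra_simps)
  show "(\<bar>u - w\<bar> - \<theta> / 2)\<^sup>2 = gap + potential u + potential w \<longleftrightarrow> (u, w) \<in> contact"
  proof (cases "u \<le> w")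
    case True
    then have "u \<noteq> S w" using less_S[of w] by auto
    then show ?thesis using ge[OF True] by (auto simp: contact_def)
  next
    case False
    then have "w \<noteq> S u" "w \<le> u" using less_S[of u] by auto
    then show ?thesis using ge[OF \<open>w \<le> u\<close>]
      by (auto simp: contact_def abs_minus_commute algebra_simps)
  qed
qed

end

section \<open>Optimality and uniqueness of couplings on the contact set\<close>

context half_shift
begin

lemma continuous_potential: "continuous_on UNIV potential"
  using DERIV_isCont[OF potential_deriv] by (simp add: continuous_on_eq_continuous_at)

definition dual_value :: real where
  "dual_value = gap + 2 * (\<integral>t. potential t * indicator {0..1} t \<partial>lborel)"

text \<open>Weak duality with complementary slackness: integrating the pointwise bound, the potential terms only see
  the margins, so the lower bound is the same for all couplings.\<close>

lemma dual_bound: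
  assumes "copula_measure \<mu>"
  shows "dual_value \<le> (\<integral>p. (\<bar>fst p - snd p\<bar> - \<theta> / 2)\<^sup>2 \<partial>\<mu>)"
    and "(\<integral>p. (\<bar>fst p - snd p\<bar> - \<theta> / 2)\<^sup>2 \<partial>\<mu>) = dual_value \<longleftrightarrow> (AE p in \<mu>. p \<in> contact)"
proof -
  interpret copula_measure \<mu> by fact
  define h where
    "h = (\<lambda>p. (\<bar>fst p - snd p\<bar> - \<theta> / 2)\<^sup>2 - (gap + potential (fst p) + potential (snd p)))"
  have int [simp]: "integrable \<mu> (\<lambda>p. (\<bar>fst p - snd p\<bar> - \<theta> / 2)\<^sup>2)"
    by (intro integrable_continuous continuous_intros)
  note pot [simp] = margin_integral[OF continuous_potential]
  have int_h: "integrable \<mu> h"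
    unfolding h_def by (intro Bochner_Integration.integrable_diff Bochner_Integration.integrable_add) simp_all
  have "(\<integral>p. h p \<partial>\<mu>) = (\<integral>p. (\<bar>fst p - snd p\<bar> - \<theta> / 2)\<^sup>2 \<partial>\<mu>) - dual_value"
    unfolding h_def dual_value_def
    by (subst Bochner_Integration.integral_diff) (simp_all add: prob_space[simplified])
  moreover have h_nonneg: "h p \<ge> 0" for p
    unfolding h_def using cost_ge[of "fst p" "snd p"] by simp
  moreover have "h p = 0 \<longleftrightarrow> p \<in> contact" for p
    unfolding h_def using cost_eq_iff[of "fst p" "snd p"] by simp
  ultimately show "dual_value \<le> (\<integral>p. (\<bar>fst p - snd p\<bar> - \<theta> / 2)\<^sup>2 \<partial>\<mu>)"
    and "(\<integral>p. (\<bar>fst p - snd p\<bar> - \<theta> / 2)\<^sup>2 \<partial>\<mu>) = dual_value \<longleftrightarrow> (AE p in \<mu>. p \<in> contact)"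
    using integral_nonneg_eq_0_iff_AE[OF int_h] integral_nonneg_AE[of h \<mu>] by auto
qed

text \<open>Expanding \<open>(\<bar>u - w\<bar> - \<theta>/2)\<^sup>2\<close>, the linear term is fixed by the constraint on \<open>E \<bar>U - V\<bar>\<close>;
  \<open>\<theta>\<close> is its Lagrange multiplier.\<close>

lemma contact_minimizes:
  assumes "copula_measure \<pi>" "AE p in \<pi>. p \<in> contact" "copula_measure \<mu>"
    and same: "(\<integral>p. \<bar>fst p - snd p\<bar> \<partial>\<mu>) = (\<integral>p. \<bar>fst p - snd p\<bar> \<partial>\<pi>)"
  shows "(\<integral>p. (fst p - snd p)\<^sup>2 \<partial>\<pi>) \<le> (\<integral>p. (fst p - snd p)\<^sup>2 \<partial>\<mu>)"
    and "(\<integral>p. (fst p - snd p)\<^sup>2 \<partial>\<pi>) = (\<integral>p. (fst p - snd p)\<^sup>2 \<partial>\<mu>) \<Longrightarrow> AE p in \<mu>. p \<in> contact"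
proof -
  have expand: "(\<integral>p. (\<bar>fst p - snd p\<bar> - \<theta> / 2)\<^sup>2 \<partial>\<nu>) =
      (\<integral>p. (fst p - snd p)\<^sup>2 \<partial>\<nu>) - \<theta> * (\<integral>p. \<bar>fst p - snd p\<bar> \<partial>\<nu>) + \<theta>\<^sup>2 / 4"
    if "copula_measure \<nu>" for \<nu>
  proof -
    interpret copula_measure \<nu> by fact
    have "(\<integral>p. (\<bar>fst p - snd p\<bar> - \<theta> / 2)\<^sup>2 \<partial>\<nu>) =
        (\<integral>p. (fst p - snd p)\<^sup>2 - \<theta> * \<bar>fst p - snd p\<bar> + \<theta>\<^sup>2 / 4 \<partial>\<nu>)"
      by (rule Bochner_Integration.integral_cong) (auto simp: power2_diff power_divide)
    then show ?thesis
      by (simp add: integrable_continuous continuous_intros prob_space[simplified])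
  qed
  show "(\<integral>p. (fst p - snd p)\<^sup>2 \<partial>\<pi>) \<le> (\<integral>p. (fst p - snd p)\<^sup>2 \<partial>\<mu>)"
    "(\<integral>p. (fst p - snd p)\<^sup>2 \<partial>\<pi>) = (\<integral>p. (fst p - snd p)\<^sup>2 \<partial>\<mu>) \<Longrightarrow> AE p in \<mu>. p \<in> contact"
    using dual_bound[OF assms(1)] dual_bound[OF assms(3)] assms(2) same
    by (simp_all add: expand assms(1,3))
qed

definition up_part :: "(real \<times> real) measure \<Rightarrow> real set \<Rightarrow> real" where
  "up_part \<mu> E = measure \<mu> {p. snd p = S (fst p) \<and> fst p \<in> E}"

definition down_part :: "(real \<times> real) measure \<Rightarrow> real set \<Rightarrow> real" where
  "down_part \<mu> E = measure \<mu> {p. fst p = S (snd p) \<and> snd p \<in> E}"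

lemma vimage_S_sets [measurable]: "E \<in> sets borel \<Longrightarrow> S -` E \<in> sets borel"
  using measurable_sets[OF borel_measurable_S, of E] by simp

lemma measure_rectangle:
  assumes "copula_measure \<mu>" "AE p in \<mu>. p \<in> contact"
    and [measurable]: "A \<in> sets borel" "B \<in> sets borel"
  shows "measure \<mu> (A \<times> B) = up_part \<mu> (A \<inter> S -` B) + down_part \<mu> (B \<inter> S -` A)"
proof -
  interpret copula_measure \<mu> by fact
  have 1: "{p. snd p = S (fst p) \<and> fst p \<in> A \<inter> S -` B} \<in> sets \<mu>"
  proof -
    have "{p \<in> space \<mu>. snd p = S (fst p) \<and> fst p \<in> A \<inter> S -` B} \<in> sets \<mu>" by measurable
    then show ?thesis by simp
  qed
  have 2: "{p. fst p = S (snd p) \<and> snd p \<in> B \<inter> S -` A} \<in> sets \<mu>"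
  proof -
    have "{p \<in> space \<mu>. fst p = S (snd p) \<and> snd p \<in> B \<inter> S -` A} \<in> sets \<mu>" by measurable
    then show ?thesis by simp
  qed
  have AB: "A \<times> B \<in> sets \<mu>"
  proof -
    have "A \<times> B = {p \<in> space \<mu>. fst p \<in> A \<and> snd p \<in> B}" by auto
    also have "\<dots> \<in> sets \<mu>" by measurable
    finally show ?thesis .
  qed
  have "measure \<mu> (A \<times> B) = measure \<mu> ({p. snd p = S (fst p) \<and> fst p \<in> A \<inter> S -` B} \<union>
      {p. fst p = S (snd p) \<and> snd p \<in> B \<inter> S -` A})"
  proof (rule measure_eq_AE)
    show "AE p in \<mu>. p \<in> A \<times> B \<longleftrightarrow> p \<in> {p. snd p = S (fst p) \<and> fst p \<in> A \<inter> S -` B} \<union>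
      {p. fst p = S (snd p) \<and> snd p \<in> B \<inter> S -` A}"
      using assms(2) by eventually_elim (auto simp: contact_def mem_Times_iff)
  qed (use 1 2 AB in auto)
  also have "\<dots> = up_part \<mu> (A \<inter> S -` B) + down_part \<mu> (B \<inter> S -` A)"
    unfolding up_part_def down_part_def
  proof (rule finite_measure_Union[OF 1 2])
    have False if "snd p = S (fst p)" "fst p = S (snd p)" for p
      using less_S[of "fst p"] less_S[of "snd p"] that by linarith
    then show "{p. snd p = S (fst p) \<and> fst p \<in> A \<inter> S -` B} \<inter>
      {p. fst p = S (snd p) \<and> snd p \<in> B \<inter> S -` A} = {}" by blast
  qed
  finally show ?thesis .
qed

text \<open>The margins give \<open>up E + down (S -` E) = down E + up (S -` E) = \<lambda> E\<close>. For two couplings the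
  differences \<open>U\<close>, \<open>D\<close> of these masses satisfy \<open>U E = - D (S -` E)\<close> and
  \<open>D E = - U (S -` E)\<close>, hence \<open>U E = U (E - \<theta>)\<close>. Translating \<open>E \<inter> {..1}\<close> to the left of the
  unit interval shows \<open>U = 0\<close>.\<close>

lemma contact_measure_unique:
  assumes \<mu>: "copula_measure \<mu>" "AE p in \<mu>. p \<in> contact"
    and \<nu>: "copula_measure \<nu>" "AE p in \<nu>. p \<in> contact"
    and A: "A \<in> sets borel" and B: "B \<in> sets borel"
  shows "measure \<mu> (A \<times> B) = measure \<nu> (A \<times> B)"
proof -
  have margins: "measure \<kappa> (E \<times> UNIV) = measure lborel (E \<inter> {0..1})"
    "measure \<kappa> (UNIV \<times> E) = measure lborel (E \<inter> {0..1})"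
    if "copula_measure \<kappa>" "E \<in> sets borel" for \<kappa> E
  proof -
    interpret copula_measure \<kappa> by fact
    have eq: "E \<times> UNIV = fst -` E" "UNIV \<times> E = (snd :: real \<times> real \<Rightarrow> real) -` E" by auto
    show "measure \<kappa> (E \<times> UNIV) = measure lborel (E \<inter> {0..1})"
      "measure \<kappa> (UNIV \<times> E) = measure lborel (E \<inter> {0..1})"
      unfolding measure_def eq margin_fst[OF that(2)] margin_snd[OF that(2)] by (rule refl)+
  qed
  define U where "U E = up_part \<mu> E - up_part \<nu> E" for E
  define D where "D E = down_part \<mu> E - down_part \<nu> E" for E
  have UD: "U E = - D (S -` E)" and DU: "D E = - U (S -` E)" if E: "E \<in> sets borel" for E
    using measure_rectangle[OF \<mu> E, of UNIV] measure_rectangle[OF \<nu> E, of UNIV]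
      measure_rectangle[OF \<mu> _ E, of UNIV] measure_rectangle[OF \<nu> _ E, of UNIV]
      margins[OF \<mu>(1) E] margins[OF \<nu>(1) E]
    by (simp_all add: U_def D_def)
  have shift: "U E = U ((\<lambda>u. u + real n * \<theta>) -` E)" if E: "E \<in> sets borel" for E n
  proof (induction n)
    case (Suc n)
    have m: "(\<lambda>u. u + real n * \<theta>) -` E \<in> sets borel"
      using E measurable_sets[of "\<lambda>u. u + real n * \<theta>" borel borel E] by simp
    have "U ((\<lambda>u. u + real n * \<theta>) -` E) = U (S -` S -` (\<lambda>u. u + real n * \<theta>) -` E)"
      using m UD DU[of "S -` (\<lambda>u. u + real n * \<theta>) -` E"] by simp
    also have "S -` S -` (\<lambda>u. u + real n * \<theta>) -` E = (\<lambda>u. u + real (Suc n) * \<theta>) -` E"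
      by (auto simp: S_S algebra_simps)
    finally show ?case using Suc by simp
  qed simp
  have U0: "U E = 0" if E: "E \<in> sets borel" for E
  proof -
    have event: "{p. snd p = S (fst p) \<and> fst p \<in> F} \<in> sets \<kappa>"
      if "copula_measure \<kappa>" and F: "F \<in> sets borel" for \<kappa> F
    proof -
      interpret copula_measure \<kappa> by fact
      have "{p \<in> space \<kappa>. snd p = S (fst p) \<and> fst p \<in> F} \<in> sets \<kappa>"
        using F by measurable
      then show ?thesis by simp
    qed
    have null: "up_part \<kappa> F = 0"
      if "copula_measure \<kappa>" and F: "F \<in> sets borel" "F \<subseteq> {..<0}" for \<kappa> F
    proof -
      interpret copula_measure \<kappa> by fact
      have "AE p in \<kappa>. p \<notin> {p. snd p = S (fst p) \<and> fst p \<in> F}"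
        using AE_unit_square by eventually_elim (use F in auto)
      with prob_eq_0[OF event[OF that(1) F(1)]] show ?thesis
        unfolding up_part_def by blast
    qed
    obtain n :: nat where n: "1 < real n * \<theta>"
      using period_pos ex_less_of_nat_mult by blast
    have split: "up_part \<kappa> E = up_part \<kappa> (E \<inter> {..1})" if "copula_measure \<kappa>" for \<kappa>
    proof -
      interpret copula_measure \<kappa> by fact
      show ?thesis unfolding up_part_def
      proof (rule measure_eq_AE)
        show "AE p in \<kappa>. p \<in> {p. snd p = S (fst p) \<and> fst p \<in> E} \<longleftrightarrow>
            p \<in> {p. snd p = S (fst p) \<and> fst p \<in> E \<inter> {..1}}"
          using AE_unit_square by eventually_elim auto
      qed (use E event that in auto)
    qed
    have "U E = U (E \<inter> {..1})" using split \<mu>(1) \<nu>(1) by (simp add: U_def)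
    also have "\<dots> = U ((\<lambda>u. u + real n * \<theta>) -` (E \<inter> {..1}))"
      using E by (intro shift) auto
    also have "\<dots> = 0"
    proof -
      let ?F = "(\<lambda>u. u + real n * \<theta>) -` (E \<inter> {..1})"
      have "?F \<in> sets borel"
        using E measurable_sets[of "\<lambda>u. u + real n * \<theta>" borel borel "E \<inter> {..1}"] by simp
      moreover have "?F \<subseteq> {..<0}" using n by auto
      ultimately show ?thesis by (simp add: U_def null \<mu>(1) \<nu>(1))
    qed
    finally show ?thesis .
  qed
  with DU have D0: "D E = 0" if "E \<in> sets borel" for E using that by simp
  show ?thesis
    using measure_rectangle[OF \<mu> A B] measure_rectangle[OF \<nu> A B]
      U0[of "A \<inter> S -` B"] D0[of "B \<inter> S -` A"] A B by (simp add: U_def D_def)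
qed

end

lemma (in half_shift) contact_copula_optimal:
  assumes \<pi>: "copula_measure \<pi>" "AE p in \<pi>. p \<in> contact"
    and C: "\<And>u v. u \<in> {0..1} \<Longrightarrow> v \<in> {0..1} \<Longrightarrow> C u v = measure \<pi> ({0..u} \<times> {0..v})"
    and D: "is_copula D" "footrule D = footrule C"
  shows "spearman_rho D \<le> spearman_rho C"
    and "spearman_rho D = spearman_rho C \<Longrightarrow> copula_eq D C"
proof -
  obtain \<mu> where \<mu>: "copula_measure \<mu>"
    and D\<mu>: "\<And>u v. u \<in> {0..1} \<Longrightarrow> v \<in> {0..1} \<Longrightarrow> D u v = measure \<mu> ({0..u} \<times> {0..v})"
    using D(1) unfolding is_copula_iff by blast
  have "(\<integral>p. \<bar>fst p - snd p\<bar> \<partial>\<mu>) = (\<integral>p. \<bar>fst p - snd p\<bar> \<partial>\<pi>)"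
    using D(2) copula_measure.footrule_eq[OF \<mu> D\<mu>] copula_measure.footrule_eq[OF \<pi>(1) C] by simp
  note min = contact_minimizes[OF \<pi> \<mu> this]
  note rho = copula_measure.spearman_rho_eq[OF \<mu> D\<mu>] copula_measure.spearman_rho_eq[OF \<pi>(1) C]
  show "spearman_rho D \<le> spearman_rho C"
    using min(1) rho by simp
  assume "spearman_rho D = spearman_rho C"
  then have "AE p in \<mu>. p \<in> contact" using min(2) rho by simp
  then show "copula_eq D C"
    unfolding copula_eq_def
    using contact_measure_unique[OF \<mu> _ \<pi>] C D\<mu> by simp
qed

section \<open>A piecewise linear half shift\<close>

text \<open>One period of the shift, measured from \<open>y\<^sub>0\<close>, has four pieces: an interval of length \<open>N v\<close> is
  stretched by \<open>1 + 1/N\<close>, one of length \<open>q\<close> is translated, one of length \<open>(N + 1) v\<close> is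
  compressed by the inverse factor, and a second one of length \<open>q\<close> is translated. The first two pieces
  have joint length \<open>h\<close> and are mapped onto the last two; those are mapped onto the first two pieces of
  the next period by the inverse map.\<close>

locale zigzag =
  fixes N :: nat and q v y\<^sub>0 :: real
  assumes N_pos: "N \<ge> 1" and v_nonneg: "v \<ge> 0" and q_nonneg: "q \<ge> 0" and h_pos: "real N * v + q > 0"
begin

definition h :: real where "h = real N * v + q"

definition period :: real where "period = 2 * h + v"

definition zig :: "real \<Rightarrow> real" where
  "zig r = (if r < h then h + r + min r (real N * v) / real N
            else period + max ((r - h) * (real N / (real N + 1))) (r - h - v))"

definition zigzag_shift :: "real \<Rightarrow> real" where
  "zigzag_shift u = (let k = real_of_int \<lfloor>(u - y\<^sub>0) / period\<rfloor> in
     y\<^sub>0 + k * period + zig (u - y\<^sub>0 - k * period))"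

lemma period_pos: "period > 0" and h_pos': "h > 0"
  using h_pos v_nonneg by (simp_all add: period_def h_def)

lemma zigzag_shift_eq:
  assumes "0 \<le> r" "r < period"
  shows "zigzag_shift (y\<^sub>0 + real_of_int k * period + r) = y\<^sub>0 + real_of_int k * period + zig r"
proof -
  have "\<lfloor>(y\<^sub>0 + real_of_int k * period + r - y\<^sub>0) / period\<rfloor> = k"
    using assms period_pos by (intro floor_unique) (auto simp: field_simps)
  then show ?thesis by (simp add: zigzag_shift_def Let_def)
qed

lemma period_split:
  obtains k :: int and r where "u = y\<^sub>0 + real_of_int k * period + r" "0 \<le> r" "r < period"
proof
  define k where "k = \<lfloor>(u - y\<^sub>0) / period\<rfloor>"
  have "real_of_int k \<le> (u - y\<^sub>0) / period" "(u - y\<^sub>0) / period < real_of_int k + 1"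
    unfolding k_def by linarith+
  then have "real_of_int k * period \<le> u - y\<^sub>0" "u - y\<^sub>0 < (real_of_int k + 1) * period"
    using period_pos by (simp_all add: field_simps)
  then show "u = y\<^sub>0 + real_of_int k * period + (u - y\<^sub>0 - real_of_int k * period)"
    "0 \<le> u - y\<^sub>0 - real_of_int k * period" "u - y\<^sub>0 - real_of_int k * period < period"
    by (simp_all add: algebra_simps)
qed

text \<open>On \<open>[0,h)\<close> the map goes onto the rest of the period, and the second branch of
  the definition is its inverse: of \<open>y N / (N + 1)\<close> and \<open>y - v\<close>, with \<open>y\<close> measured from \<open>h\<close>, the maximum selects the inverse
  of the stretched piece below \<open>(N + 1) v\<close> and of the translated piece above.\<close>

lemma zig_low:
  assumes "0 \<le> r" "r < h"
  shows "h \<le> zig r" "zig r < period" "zig (zig r) = period + r"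
proof -
  define m where "m = min r (real N * v) / real N"
  have m: "0 \<le> m" "m \<le> v" "real N * m = min r (real N * v)"
    using assms N_pos v_nonneg by (auto simp: m_def field_simps min_def)
  have z: "zig r = h + r + m" using assms by (simp add: zig_def m_def)
  show "h \<le> zig r" "zig r < period"
    using z m assms by (simp_all add: period_def)
  have "max ((r + m) * (real N / (real N + 1))) (r + m - v) = r"
  proof (cases "r \<le> real N * v")
    case True
    then have "(r + m) * (real N / (real N + 1)) = r"
      using m(3) N_pos by (simp add: field_simps)
    with m show ?thesis by (simp add: max_def)
  next
    case False
    then have "m = v" using N_pos by (simp add: m_def)
    moreover have "(r + v) * (real N / (real N + 1)) \<le> r"
      using False by (simp add: field_simps)
    ultimately show ?thesis by (simp add: max_def)
  qed
  then show "zig (zig r) = period + r"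
    using z m assms by (simp add: zig_def)
qed

lemma zig_high:
  assumes "h \<le> r" "r < period"
  shows "0 \<le> zig r - period" "zig r - period < h" "zig (zig r - period) = r"
proof -
  define y where "y = r - h"
  define s where "s = max (y * (real N / (real N + 1))) (y - v)"
  have y: "0 \<le> y" "y < h + v" using assms by (simp_all add: y_def period_def)
  have z: "zig r - period = s" using assms by (simp add: zig_def s_def y_def)
  have hN: "real N * v \<le> h" using q_nonneg by (simp add: h_def)
  have "0 \<le> s" using y by (simp add: s_def le_max_iff_disj)
  have "y * real N < (h + v) * real N"
    using y N_pos by (intro mult_strict_right_mono) auto
  also have "\<dots> \<le> h * (real N + 1)" using hN by (simp add: algebra_simps)
  finally have "y * (real N / (real N + 1)) < h" by (simp add: field_simps)
  with y have "s < h" by (simp add: s_def)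
  have "s + min s (real N * v) / real N = y"
  proof (cases "y \<le> (real N + 1) * v")
    case True
    then have "y - v \<le> y * (real N / (real N + 1))" by (simp add: field_simps)
    then have "s = y * (real N / (real N + 1))" by (simp add: s_def)
    moreover have "y * (real N / (real N + 1)) \<le> real N * v"
    proof -
      have "y * real N \<le> ((real N + 1) * v) * real N"
        using True by (intro mult_right_mono) auto
      then have "y * real N \<le> (real N * v) * (real N + 1)" by (simp only: mult_ac)
      then show ?thesis by (simp add: pos_divide_le_eq)
    qed
    ultimately have "min s (real N * v) = s" "s * (real N + 1) = y * real N"
      by simp_all
    then show ?thesis using N_pos by (simp add: field_simps)
  next
    case False
    then have "y * (real N / (real N + 1)) \<le> y - v" by (simp add: field_simps)
    then have "s = y - v" by (simp add: s_def)
    moreover from this False have "real N * v \<le> s" by (simp add: algebra_simps)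
    ultimately show ?thesis using N_pos by (simp add: min_def)
  qed
  with \<open>0 \<le> s\<close> \<open>s < h\<close> z show "0 \<le> zig r - period" "zig r - period < h" "zig (zig r - period) = r"
    by (simp_all add: zig_def y_def)
qed

lemma zig_strict_mono:
  assumes "0 \<le> r" "r < r'" "r' < period"
  shows "zig r < zig r'"
proof -
  consider "r' < h" | "r < h" "h \<le> r'" | "h \<le> r" by fastforce
  then show ?thesis
  proof cases
    case 1
    have "min r (real N * v) / real N \<le> min r' (real N * v) / real N"
      using assms by (intro divide_right_mono) auto
    with 1 assms show ?thesis by (simp add: zig_def)
  next
    case 2
    then show ?thesis using zig_low(2)[of r] zig_high(1)[of r'] assms by simp
  next
    case 3
    have "(r - h) * (real N / (real N + 1)) < (r' - h) * (real N / (real N + 1))"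
      using assms N_pos by (intro mult_strict_right_mono) auto
    moreover have "r - h - v < r' - h - v" using assms by simp
    ultimately show ?thesis using 3 assms by (auto simp: zig_def max_def)
  qed
qed

lemma zig_bounds:
  assumes "0 \<le> r" "r < period"
  shows "h \<le> zig r" "zig r < period + h"
  using zig_low[of r] zig_high[of r] assms h_pos' period_pos v_nonneg
  by (cases "r < h"; simp add: period_def)+

sublocale half_shift zigzag_shift period
proof
  show "period > 0" by (rule period_pos)
  show "strict_mono zigzag_shift"
  proof (rule strict_monoI)
    fix u w :: real assume "u < w"
    obtain k r where u: "u = y\<^sub>0 + real_of_int k * period + r" "0 \<le> r" "r < period"
      by (rule period_split)
    obtain l s where w: "w = y\<^sub>0 + real_of_int l * period + s" "0 \<le> s" "s < period"
      by (rule period_split)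
    have Su: "zigzag_shift u = y\<^sub>0 + real_of_int k * period + zig r"
      and Sw: "zigzag_shift w = y\<^sub>0 + real_of_int l * period + zig s"
      using u w by (simp_all add: zigzag_shift_eq)
    consider "k = l" | "k < l" | "l < k" by linarith
    then show "zigzag_shift u < zigzag_shift w"
    proof cases
      case 1
      have "real_of_int k * period = real_of_int l * period" using 1 by (rule arg_cong)
      then have "r < s" using \<open>u < w\<close> u(1) w(1) by linarith
      from zig_strict_mono[OF u(2) this w(3)] show ?thesis
        unfolding Su Sw \<open>real_of_int k * period = real_of_int l * period\<close> by simp
    next
      case 2
      then have "real_of_int k + 1 \<le> real_of_int l" by linarith
      then have "(real_of_int k + 1) * period \<le> real_of_int l * period"
        using period_pos by (intro mult_right_mono) simp_all
      then show ?thesis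
        using zig_bounds(2)[OF u(2,3)] zig_bounds(1)[OF w(2,3)] by (simp add: Su Sw algebra_simps)
    next
      case 3
      then have "real_of_int l + 1 \<le> real_of_int k" by linarith
      then have "(real_of_int l + 1) * period \<le> real_of_int k * period"
        using period_pos by (intro mult_right_mono) simp_all
      with u w \<open>u < w\<close> show ?thesis by (simp add: algebra_simps)
    qed
  qed
  show "zigzag_shift (zigzag_shift u) = u + period" for u
  proof -
    obtain k r where u: "u = y\<^sub>0 + real_of_int k * period + r" "0 \<le> r" "r < period"
      by (rule period_split)
    have Su: "zigzag_shift u = y\<^sub>0 + real_of_int k * period + zig r"
      using u by (simp add: zigzag_shift_eq)
    show ?thesis
    proof (cases "r < h")
      case True
      with u zig_low[of r] h_pos' show ?thesis
        by (simp add: Su zigzag_shift_eq)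
    next
      case False
      then have r: "h \<le> r" by simp
      have "zigzag_shift u = y\<^sub>0 + real_of_int (k + 1) * period + (zig r - period)"
        by (simp add: Su algebra_simps)
      also have "zigzag_shift \<dots> = y\<^sub>0 + real_of_int (k + 1) * period + r"
        using zig_high[OF r u(3)] v_nonneg h_pos' by (subst zigzag_shift_eq) (auto simp: period_def)
      finally show ?thesis by (simp add: u algebra_simps)
    qed
  qed
qed

text \<open>The pieces are taken closed because the segments below contain their end points, where two
  branches of the definition agree.\<close>

lemma shift_low:
  assumes "0 \<le> r" "r \<le> h"
  shows "zigzag_shift (y\<^sub>0 + real_of_int k * period + r) =
    y\<^sub>0 + real_of_int k * period + h + r + min r (real N * v) / real N"
proof (cases "r < h")
  case True
  then show ?thesis
    using assms h_pos' v_nonneg by (subst zigzag_shift_eq) (auto simp: period_def zig_def)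
next
  case False
  with assms have r: "r = h" by simp
  have "min h (real N * v) = real N * v" using q_nonneg by (simp add: h_def)
  with r show ?thesis
    using h_pos' v_nonneg N_pos by (subst zigzag_shift_eq) (auto simp: period_def zig_def)
qed

lemma shift_high:
  assumes "h \<le> r" "r \<le> period"
  shows "zigzag_shift (y\<^sub>0 + real_of_int k * period + r) =
    y\<^sub>0 + real_of_int (k + 1) * period + max ((r - h) * (real N / (real N + 1))) (r - h - v)"
proof (cases "r < period")
  case True
  then show ?thesis
    using assms h_pos' by (subst zigzag_shift_eq) (auto simp: zig_def algebra_simps)
next
  case False
  with assms have r: "r = period" by simp
  have "(h + v) * (real N / (real N + 1)) \<le> h"
    using q_nonneg by (simp add: h_def field_simps)
  then have m: "max ((period - h) * (real N / (real N + 1))) (period - h - v) = h"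
    by (simp add: period_def)
  have z: "zigzag_shift (y\<^sub>0 + real_of_int (k + 1) * period + 0) =
      y\<^sub>0 + real_of_int (k + 1) * period + h"
    using h_pos' v_nonneg N_pos by (subst zigzag_shift_eq) (auto simp: period_def zig_def)
  have e: "y\<^sub>0 + real_of_int k * period + period = y\<^sub>0 + real_of_int (k + 1) * period + 0"
    by (simp add: algebra_simps)
  show ?thesis unfolding r e z m by (rule refl)
qed

end

section \<open>Integration along segments\<close>

lemma nn_integral_mixture:
  fixes M :: "'i \<Rightarrow> 'a :: topological_space measure"
  assumes "finite I" and sets_\<nu>: "sets \<nu> = sets borel" and sets_M: "\<And>i. i \<in> I \<Longrightarrow> sets (M i) = sets borel"
    and mix: "\<And>E. E \<in> sets borel \<Longrightarrow> emeasure \<nu> E = (\<Sum>i\<in>I. c i * emeasure (M i) E)"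
    and f: "f \<in> borel_measurable borel"
  shows "(\<integral>\<^sup>+x. f x \<partial>\<nu>) = (\<Sum>i\<in>I. c i * (\<integral>\<^sup>+x. f x \<partial>M i))"
  using f
proof (induction rule: borel_measurable_induct)
  case (cong f g)
  have "(\<integral>\<^sup>+x. f x \<partial>\<nu>) = (\<integral>\<^sup>+x. g x \<partial>\<nu>)"
    using cong sets_eq_imp_space_eq[OF sets_\<nu>] by (intro nn_integral_cong) simp
  moreover have "(\<integral>\<^sup>+x. f x \<partial>M i) = (\<integral>\<^sup>+x. g x \<partial>M i)" if "i \<in> I" for i
    using cong sets_eq_imp_space_eq[OF sets_M[OF that]] by (intro nn_integral_cong) simp
  ultimately show ?case using cong by simp
next
  case (set A)
  then show ?case by (simp add: mix sets_\<nu> sets_M)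
next
  case (mult u a)
  have "u \<in> borel_measurable \<nu>" "\<And>i. i \<in> I \<Longrightarrow> u \<in> borel_measurable (M i)"
    using mult(2) by (simp_all add: measurable_cong_sets[OF sets_\<nu> refl] measurable_cong_sets[OF sets_M refl])
  then show ?case using mult
    by (simp add: nn_integral_cmult sum_distrib_left mult.left_commute)
next
  case (add u w)
  have "u \<in> borel_measurable \<nu>" "\<And>i. i \<in> I \<Longrightarrow> u \<in> borel_measurable (M i)"
    "w \<in> borel_measurable \<nu>" "\<And>i. i \<in> I \<Longrightarrow> w \<in> borel_measurable (M i)"
    using add(1,3,4) by (simp_all add: measurable_cong_sets[OF sets_\<nu> refl] measurable_cong_sets[OF sets_M refl])
  then show ?case using add
    by (simp add: nn_integral_add sum.distrib distrib_left)
next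
  case (seq U)
  have m: "U n \<in> borel_measurable \<nu>" "\<And>i. i \<in> I \<Longrightarrow> U n \<in> borel_measurable (M i)" for n
    using seq(1) by (simp_all add: measurable_cong_sets[OF sets_\<nu> refl] measurable_cong_sets[OF sets_M refl])
  have "(\<integral>\<^sup>+x. (SUP n. U n x) \<partial>\<nu>) = (SUP n. \<integral>\<^sup>+x. U n x \<partial>\<nu>)"
    using seq m by (intro nn_integral_monotone_convergence_SUP) auto
  also have "\<dots> = (SUP n. \<Sum>i\<in>I. c i * (\<integral>\<^sup>+x. U n x \<partial>M i))"
    using seq by simp
  also have "\<dots> = (\<Sum>i\<in>I. SUP n. c i * (\<integral>\<^sup>+x. U n x \<partial>M i))"
  proof (rule ennreal_SUP_sum)
    show "incseq (\<lambda>n. c i * (\<integral>\<^sup>+x. U n x \<partial>M i))" for i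
      using \<open>incseq U\<close> by (intro incseq_SucI mult_left_mono nn_integral_mono) (auto simp: incseq_Suc_iff le_fun_def)
  qed
  also have "\<dots> = (\<Sum>i\<in>I. c i * (\<integral>\<^sup>+x. (SUP n. U n x) \<partial>M i))"
    using seq m by (intro sum.cong refl)
      (simp add: SUP_mult_left_ennreal nn_integral_monotone_convergence_SUP)
  finally show ?case by (simp add: image_comp)
qed

lemma nn_integral_push_leb:
  assumes [measurable]: "F \<in> borel_measurable borel" "f \<in> borel_measurable borel"
  shows "(\<integral>\<^sup>+p. f p \<partial>push_leb F a) = (\<integral>\<^sup>+t. f (F t) * indicator {0..a} t \<partial>lborel)"
proof -
  have "F \<in> measurable (restrict_space lborel {0..a}) borel"
    by (intro measurable_restrict_space1) simp
  then show ?thesis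
    unfolding push_leb_def by (simp add: nn_integral_distr nn_integral_restrict_space)
qed

definition mass_upto :: "real set \<Rightarrow> real \<Rightarrow> real" where
  "mass_upto E y = measure lborel (E \<inter> {0..y})"

lemma mass_upto_mono: "E \<in> sets borel \<Longrightarrow> x \<le> y \<Longrightarrow> mass_upto E x \<le> mass_upto E y"
proof -
  assume E: "E \<in> sets borel" and "x \<le> y"
  have "emeasure lborel (E \<inter> {0..y}) \<le> emeasure lborel {0..y}"
    using E by (intro emeasure_mono) auto
  also have "\<dots> < \<infinity>" by (cases "0 \<le> y") auto
  finally show ?thesis
    unfolding mass_upto_def using E \<open>x \<le> y\<close>
    by (intro measure_mono_fmeasurable) (auto simp: fmeasurable_def)
qed

lemma emeasure_interval_mass:
  assumes E [measurable]: "E \<in> sets borel" and "0 \<le> x" "x \<le> y"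
  shows "emeasure lborel (E \<inter> {x..y}) = ennreal (mass_upto E y - mass_upto E x)"
proof -
  have fin: "emeasure lborel (E \<inter> {a..b}) < \<infinity>" for a b
  proof -
    have "emeasure lborel (E \<inter> {a..b}) \<le> emeasure lborel {a..b}"
      by (intro emeasure_mono) auto
    also have "\<dots> < \<infinity>" by (cases "a \<le> b") auto
    finally show ?thesis .
  qed
  have eq: "emeasure lborel (E \<inter> {a..b}) = ennreal (measure lborel (E \<inter> {a..b}))" for a b
    using fin[of a b] by (intro emeasure_eq_ennreal_measure) auto
  have "emeasure lborel (E \<inter> {0..y}) = emeasure lborel ((E \<inter> {0..x}) \<union> (E \<inter> {x..y}))"
    using assms by (intro arg_cong[of _ _ "emeasure lborel"]) auto
  also have "\<dots> = emeasure lborel (E \<inter> {0..x}) + emeasure lborel (E \<inter> {x..y})"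
  proof (rule emeasure_Un')
    have "(E \<inter> {0..x}) \<inter> (E \<inter> {x..y}) \<subseteq> {x}" by auto
    then have "emeasure lborel ((E \<inter> {0..x}) \<inter> (E \<inter> {x..y})) \<le> emeasure lborel {x}"
      by (intro emeasure_mono) auto
    then show "E \<inter> {0..x} \<inter> (E \<inter> {x..y}) \<in> null_sets lborel" by auto
  qed auto
  finally have "mass_upto E y = mass_upto E x + measure lborel (E \<inter> {x..y})"
    unfolding eq mass_upto_def by (simp flip: ennreal_plus)
  then show ?thesis by (simp add: eq)
qed

text \<open>A segment whose coordinate moves with speed \<open>\<sigma>\<close> pushes Lebesgue measure to the uniform
  density \<open>1/\<sigma>\<close> on its shadow. Writing the mass of an interval as an increment of
  \<open>mass_upto E\<close> later turns the statement that shadows tile \<open>[0,1]\<close> into a telescoping sum.\<close>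

lemma nn_integral_affine_indicator:
  assumes E [measurable]: "E \<in> sets borel" and "0 \<le> x" "0 < \<sigma>" "0 \<le> a"
  shows "(\<integral>\<^sup>+t. indicator E (x + \<sigma> * t) * indicator {0..a} t \<partial>lborel) =
    ennreal ((mass_upto E (x + \<sigma> * a) - mass_upto E x) / \<sigma>)"
proof -
  let ?I = "\<integral>\<^sup>+t. indicator E (x + \<sigma> * t) * indicator {0..a} t \<partial>lborel"
  have m: "0 \<le> mass_upto E (x + \<sigma> * a) - mass_upto E x"
    using mass_upto_mono[OF E, of x "x + \<sigma> * a"] assms by simp
  have "ennreal (mass_upto E (x + \<sigma> * a) - mass_upto E x) =
      (\<integral>\<^sup>+t. indicator (E \<inter> {x..x + \<sigma> * a}) t \<partial>lborel)"
    using assms by (simp add: emeasure_interval_mass)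
  also have "\<dots> = ennreal \<bar>\<sigma>\<bar> * (\<integral>\<^sup>+t. indicator (E \<inter> {x..x + \<sigma> * a}) (x + \<sigma> * t) \<partial>lborel)"
    using assms by (intro nn_integral_real_affine) auto
  also have "(\<integral>\<^sup>+t. indicator (E \<inter> {x..x + \<sigma> * a}) (x + \<sigma> * t) \<partial>lborel) = ?I"
    using assms by (intro nn_integral_cong) (auto simp: indicator_def zero_le_mult_iff)
  finally have "ennreal (mass_upto E (x + \<sigma> * a) - mass_upto E x) = ennreal \<sigma> * ?I"
    using assms by simp
  then have "ennreal (1 / \<sigma>) * ennreal (mass_upto E (x + \<sigma> * a) - mass_upto E x) =
      ennreal (1 / \<sigma>) * ennreal \<sigma> * ?I"
    by (simp add: mult.assoc)
  moreover have "ennreal (1 / \<sigma>) * ennreal \<sigma> = 1"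
    using assms by (simp flip: ennreal_mult)
  moreover have "ennreal (1 / \<sigma>) * ennreal (mass_upto E (x + \<sigma> * a) - mass_upto E x) =
      ennreal ((mass_upto E (x + \<sigma> * a) - mass_upto E x) / \<sigma>)"
    using assms m by (simp flip: ennreal_mult)
  ultimately show ?thesis by simp
qed

lemma nn_integral_power_affine:
  fixes a b c :: real
  assumes "0 \<le> a" "c \<noteq> 0" "0 \<le> b" "0 \<le> b + c * a"
  shows "(\<integral>\<^sup>+t. ennreal ((b + c * t) ^ j) * indicator {0..a} t \<partial>lborel) =
    ennreal (((b + c * a) ^ Suc j - b ^ Suc j) / (c * real (Suc j)))"
proof -
  have nn: "0 \<le> b + c * t" if "0 \<le> t" "t \<le> a" for t
  proof (cases "c \<ge> 0")
    case False
    then have "c * a \<le> c * t" using that by (intro mult_left_mono_neg) auto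
    then show ?thesis using assms by simp
  qed (use assms that in auto)
  have "(\<integral>\<^sup>+t. ennreal ((b + c * t) ^ j) * indicator {0..a} t \<partial>lborel) =
      ennreal ((b + c * a) ^ Suc j / (c * real (Suc j)) - (b + c * 0) ^ Suc j / (c * real (Suc j)))"
  proof (rule nn_integral_FTC_Icc)
    fix t assume "t \<in> {0..a}"
    then have t: "0 \<le> t" "t \<le> a" by simp_all
    show "((\<lambda>t. (b + c * t) ^ Suc j / (c * real (Suc j))) has_real_derivative (b + c * t) ^ j) (at t)"
      using assms by (auto intro!: derivative_eq_intros simp del: power_Suc of_nat_Suc simp: field_simps)
    show "0 \<le> (b + c * t) ^ j" using nn[OF t] by simp
  qed (use assms in auto)
  then show ?thesis by (simp add: diff_divide_distrib)
qed

section \<open>Chains of segments\<close>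

text \<open>The \<open>k\<close>-th stretched interval carries weight \<open>1 - k/N\<close> from the segment leaving it and weight
  \<open>k/N\<close> from the segment arriving in it, in total \<open>1\<close> also for \<open>k = 0\<close> and \<open>k = N\<close>.\<close>

lemma sum_weighted_neighbours:
  fixes X :: "nat \<Rightarrow> real"
  assumes "N \<ge> 1"
  shows "(\<Sum>k<N. alpha_wt N k * X k) + (\<Sum>k<N. beta_wt N k * X (Suc k)) = (\<Sum>k\<le>N. X k)"
proof -
  have "(\<Sum>k<N. beta_wt N k * X (Suc k) - real k / real N * X k) =
      (\<Sum>k<N. real (Suc k) / real N * X (Suc k) - real k / real N * X k)"
    by (simp add: beta_wt_def add.commute)
  also have "\<dots> = X N"
    using assms by (subst sum_lessThan_telescope) simp
  finally have "(\<Sum>k<N. beta_wt N k * X (Suc k)) = (\<Sum>k<N. real k / real N * X k) + X N"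
    by (simp add: sum_subtractf)
  moreover have "(\<Sum>k<N. alpha_wt N k * X k) = (\<Sum>k<N. X k) - (\<Sum>k<N. real k / real N * X k)"
    by (simp add: alpha_wt_def left_diff_distrib sum_subtractf)
  moreover have "(\<Sum>k\<le>N. X k) = (\<Sum>k<N. X k) + X N"
    by (simp add: lessThan_Suc_atMost[symmetric])
  ultimately show ?thesis by simp
qed

lemma wt_add: "N \<ge> 1 \<Longrightarrow> alpha_wt N k + beta_wt N k = (real N + 1) / real N"
  by (simp add: alpha_wt_def beta_wt_def field_simps)

lemma wt_nonneg: "k < N \<Longrightarrow> 0 \<le> alpha_wt N k" "0 \<le> beta_wt N k"
  by (simp_all add: alpha_wt_def beta_wt_def)

lemma alpha_sum_ennreal:
  assumes "\<And>k. 0 \<le> X k"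
  shows "(\<Sum>k<N. ennreal (alpha_wt N k * X k)) = ennreal (\<Sum>k<N. alpha_wt N k * X k)"
    and "0 \<le> (\<Sum>k<N. alpha_wt N k * X k)"
proof -
  have "0 \<le> alpha_wt N k * X k" if "k < N" for k
    using that assms by (intro mult_nonneg_nonneg wt_nonneg)
  then show "(\<Sum>k<N. ennreal (alpha_wt N k * X k)) = ennreal (\<Sum>k<N. alpha_wt N k * X k)"
    and "0 \<le> (\<Sum>k<N. alpha_wt N k * X k)"
    by (auto intro: sum_ennreal sum_nonneg)
qed

text \<open>The construction of \<open>\<nu>\<^sub>x\<close> for both halves of \<open>I\<^sub>N\<close>. The halves differ in the position and
  number of the segments \<open>A\<^sub>k\<close> (start \<open>z\<close>, displacement \<open>g\<close>, indices \<open>K\<close>) and in the phase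
  \<open>y\<^sub>0\<close>. The assumption \<open>tiling\<close> says that the shadows of all segments partition \<open>[0,1]\<close>,
  in a form that holds for every increment function \<open>G\<close>.\<close>

locale chain = zigzag +
  fixes K :: "nat set" and z g :: real
  assumes finite_K: "finite K" and y\<^sub>0_nonneg: "y\<^sub>0 \<ge> 0" and z_nonneg: "z \<ge> 0" and g_nonneg: "g \<ge> 0"
    and flat_contact: "k \<in> K \<Longrightarrow> 0 \<le> s \<Longrightarrow> s \<le> q \<Longrightarrow>
      zigzag_shift (real k * period + z + s) = real k * period + z + s + g"
    and tiling: "\<And>G :: real \<Rightarrow> real.
      (\<Sum>k\<in>K. (G (real k * period + z + q) - G (real k * period + z)) +
             (G (real k * period + z + g + q) - G (real k * period + z + g))) +
      (\<Sum>k\<le>N. G (y\<^sub>0 + real k * period + real N * v) - G (y\<^sub>0 + real k * period)) +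
      (\<Sum>k<N. G (y\<^sub>0 + real k * period + h + (real N + 1) * v) - G (y\<^sub>0 + real k * period + h))
      = G 1 - G 0"
begin

definition A_seg :: "nat \<Rightarrow> real \<Rightarrow> real \<times> real" where
  "A_seg k s = (real k * period + z + s, real k * period + z + s + g)"

definition B_seg :: "nat \<Rightarrow> real \<Rightarrow> real \<times> real" where
  "B_seg k t = (y\<^sub>0 + real k * period + t, y\<^sub>0 + real k * period + t + (h + t / real N))"

definition C_seg :: "nat \<Rightarrow> real \<Rightarrow> real \<times> real" where
  "C_seg k t = (y\<^sub>0 + real k * period + t + (h + t / real N), y\<^sub>0 + (real k + 1) * period + t)"

definition nu :: "(real \<times> real) measure" where
  "nu = borel_measure_of (\<lambda>E.
       (\<Sum>k\<in>K. emeasure (push_leb (A_seg k) q) E)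
     + (\<Sum>k<N. ennreal (alpha_wt N k) * emeasure (push_leb (B_seg k) (real N * v)) E)
     + (\<Sum>k<N. ennreal (beta_wt N k) * emeasure (push_leb (C_seg k) (real N * v)) E))"

definition \<pi> :: "(real \<times> real) measure" where
  "\<pi> = borel_measure_of (\<lambda>E. emeasure nu E + emeasure (distr nu borel prod.swap) E)"

lemma sets_nu [simp, measurable_cong]: "sets nu = sets borel"
  by (simp add: nu_def)

lemma sets_\<pi> [simp, measurable_cong]: "sets \<pi> = sets borel"
  by (simp add: \<pi>_def)

lemma seg_measurable [measurable]:
  "A_seg k \<in> borel_measurable borel" "B_seg k \<in> borel_measurable borel" "C_seg k \<in> borel_measurable borel"
  unfolding A_seg_def B_seg_def C_seg_def
  by (intro borel_measurable_continuous_onI continuous_intros; use N_pos in simp)+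

lemma emeasure_nu:
  assumes "E \<in> sets borel"
  shows "emeasure nu E =
       (\<Sum>k\<in>K. emeasure (push_leb (A_seg k) q) E)
     + (\<Sum>k<N. ennreal (alpha_wt N k) * emeasure (push_leb (B_seg k) (real N * v)) E)
     + (\<Sum>k<N. ennreal (beta_wt N k) * emeasure (push_leb (C_seg k) (real N * v)) E)"
  unfolding nu_def using assms
  by (intro emeasure_borel_measure_of countably_additive_add countably_additive_sum
        countably_additive_cmult countably_additive_emeasure_borel sets_push_leb) simp_all

lemma nn_integral_nu:
  assumes f [measurable]: "f \<in> borel_measurable borel"
  shows "(\<integral>\<^sup>+p. f p \<partial>nu) =
       (\<Sum>k\<in>K. \<integral>\<^sup>+s. f (A_seg k s) * indicator {0..q} s \<partial>lborel)
     + (\<Sum>k<N. ennreal (alpha_wt N k) * (\<integral>\<^sup>+t. f (B_seg k t) * indicator {0..real N * v} t \<partial>lborel))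
     + (\<Sum>k<N. ennreal (beta_wt N k) * (\<integral>\<^sup>+t. f (C_seg k t) * indicator {0..real N * v} t \<partial>lborel))"
proof -
  define c where "c = case_sum (\<lambda>_::nat. 1) (case_sum (\<lambda>k. ennreal (alpha_wt N k)) (\<lambda>k. ennreal (beta_wt N k)))"
  define M where "M = case_sum (\<lambda>k. push_leb (A_seg k) q) (case_sum (\<lambda>k. push_leb (B_seg k) (real N * v))
    (\<lambda>k. push_leb (C_seg k) (real N * v)))"
  have "(\<integral>\<^sup>+p. f p \<partial>nu) = (\<Sum>i\<in>K <+> ({..<N} <+> {..<N}). c i * (\<integral>\<^sup>+p. f p \<partial>M i))"
  proof (rule nn_integral_mixture)
    show "sets (M i) = sets borel" for i
      by (auto simp: M_def split: sum.splits)
    show "emeasure nu E = (\<Sum>i\<in>K <+> ({..<N} <+> {..<N}). c i * emeasure (M i) E)" if "E \<in> sets borel" for E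
      using that by (simp add: emeasure_nu sum.Plus finite_K c_def M_def add.assoc)
  qed (simp_all add: finite_K)
  then show ?thesis
    by (simp add: sum.Plus finite_K c_def M_def nn_integral_push_leb add.assoc)
qed

lemma swap_measurable [measurable]: "prod.swap \<in> borel_measurable (borel :: (real \<times> real) measure)"
  unfolding prod.swap_def[abs_def] by (intro borel_measurable_continuous_onI continuous_intros)

lemma emeasure_\<pi>: "E \<in> sets borel \<Longrightarrow> emeasure \<pi> E = emeasure nu E + emeasure (distr nu borel prod.swap) E"
  unfolding \<pi>_def
  by (intro emeasure_borel_measure_of countably_additive_add countably_additive_emeasure_borel) simp_all

lemma nn_integral_\<pi>:
  assumes f [measurable]: "f \<in> borel_measurable borel"
  shows "(\<integral>\<^sup>+p. f p \<partial>\<pi>) = (\<integral>\<^sup>+p. f p \<partial>nu) + (\<integral>\<^sup>+p. f (prod.swap p) \<partial>nu)"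
proof -
  have "(\<integral>\<^sup>+p. f p \<partial>\<pi>) = (\<Sum>b\<in>(UNIV :: bool set). 1 * (\<integral>\<^sup>+p. f p \<partial>(if b then nu else distr nu borel prod.swap)))"
    by (rule nn_integral_mixture) (auto simp: emeasure_\<pi> UNIV_bool add.commute)
  also have "\<dots> = (\<integral>\<^sup>+p. f p \<partial>nu) + (\<integral>\<^sup>+p. f (prod.swap p) \<partial>nu)"
    by (simp add: UNIV_bool nn_integral_distr add.commute)
  finally show ?thesis .
qed

lemma \<pi>_symmetric:
  assumes "E \<in> sets borel"
  shows "emeasure \<pi> (prod.swap -` E) = emeasure \<pi> E"
proof -
  have E': "prod.swap -` E \<in> sets borel"
    using measurable_sets[OF swap_measurable assms] by simp
  have "emeasure (distr nu borel prod.swap) F = emeasure nu (prod.swap -` F)" if "F \<in> sets borel" for F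
    using that sets_eq_imp_space_eq[OF sets_nu] by (subst emeasure_distr) auto
  moreover have "prod.swap -` prod.swap -` E = E" by (auto simp: prod.swap_def)
  ultimately show ?thesis
    using assms E' by (simp add: emeasure_\<pi> add.commute)
qed

lemma Nv_le_h: "real N * v \<le> h"
  using q_nonneg by (simp add: h_def)

text \<open>Along \<open>B\<^sub>k\<close> the shift stretches, along \<open>C\<^sub>k\<close> it undoes the stretching into the next period.\<close>

lemma seg_contact:
  shows "k \<in> K \<Longrightarrow> 0 \<le> s \<Longrightarrow> s \<le> q \<Longrightarrow> A_seg k s \<in> contact"
    and "0 \<le> t \<Longrightarrow> t \<le> real N * v \<Longrightarrow> B_seg k t \<in> contact"
    and "0 \<le> t \<Longrightarrow> t \<le> real N * v \<Longrightarrow> C_seg k t \<in> contact"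
proof -
  show "A_seg k s \<in> contact" if "k \<in> K" "0 \<le> s" "s \<le> q"
    using flat_contact[OF that] by (simp add: A_seg_def contact_def)
  assume t: "0 \<le> t" "t \<le> real N * v"
  show "B_seg k t \<in> contact"
    using shift_low[of t "int k"] t Nv_le_h by (simp add: B_seg_def contact_def)
  have tv: "t / real N \<le> v" using t N_pos by (simp add: field_simps)
  have "t + t / real N = t * ((real N + 1) / real N)"
    using N_pos by (simp add: field_simps)
  then have "(t + t / real N) * (real N / (real N + 1)) = t"
    using N_pos by simp
  then have "max ((h + t + t / real N - h) * (real N / (real N + 1))) (h + t + t / real N - h - v) = t"
    using tv by (simp add: max_def)
  moreover have "h + t + t / real N \<le> period"
    using t tv Nv_le_h by (simp add: period_def)
  ultimately show "C_seg k t \<in> contact"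
    using shift_high[of "h + t + t / real N" "int k"] t
    by (simp add: C_seg_def contact_def algebra_simps)
qed

lemma nu_contact: "emeasure nu (- contact) = 0"
proof -
  have [measurable]: "- contact \<in> sets borel" by simp
  have "(\<integral>\<^sup>+s. indicator (- contact) (A_seg k s) * indicator {0..q} s \<partial>lborel) = 0" if "k \<in> K" for k
    using seg_contact(1)[OF that] by (intro nn_integral_zero') (auto simp: indicator_def)
  moreover have "(\<integral>\<^sup>+t. indicator (- contact) (B_seg k t) * indicator {0..real N * v} t \<partial>lborel) = 0"
    "(\<integral>\<^sup>+t. indicator (- contact) (C_seg k t) * indicator {0..real N * v} t \<partial>lborel) = 0" for k
    using seg_contact(2,3) by (intro nn_integral_zero'; auto simp: indicator_def)+
  ultimately have "(\<integral>\<^sup>+p. indicator (- contact) p \<partial>nu) = 0"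
    by (subst nn_integral_nu) auto
  then show ?thesis by simp
qed

lemma AE_\<pi>_contact: "AE p in \<pi>. p \<in> contact"
proof (rule AE_I[of _ _ "- contact"])
  have c [measurable]: "- contact \<in> sets borel" by simp
  have "prod.swap -` (- contact) = - contact" by (auto simp: contact_def)
  then show "emeasure \<pi> (- contact) = 0"
    using sets_eq_imp_space_eq[OF sets_nu]
    by (simp add: emeasure_\<pi> emeasure_distr nu_contact)
qed auto

text \<open>The first margin of \<open>\<pi>\<close> is the sum of both margins of \<open>\<nu>\<close>. On the compressed intervals the
  segments \<open>B\<^sub>k\<close> and \<open>C\<^sub>k\<close> move with speed \<open>\<sigma> = (N + 1)/N\<close>, which is also the sum of their
  weights, so the density is \<open>1\<close>; on the stretched intervals the weights of neighbouring segments add up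
  to \<open>1\<close>.\<close>

lemma nu_margins:
  assumes E [measurable]: "E \<in> sets borel"
  shows "emeasure nu (fst -` E) + emeasure nu (snd -` E) = emeasure lborel (E \<inter> {0..1})"
proof -
  define G where "G = mass_upto E"
  define D where "D x a = G (x + a) - G x" for x a
  define \<sigma> where "\<sigma> = (real N + 1) / real N"
  have Np: "real N > 0" using N_pos by simp
  have \<sigma>: "\<sigma> > 0" using Np by (simp add: \<sigma>_def)
  have D: "D x a \<ge> 0" if "a \<ge> 0" for x a
    using mass_upto_mono[OF E, of x "x + a"] that by (simp add: D_def G_def)
  have int1: "(\<integral>\<^sup>+t. indicator E (x + t) * indicator {0..a} t \<partial>lborel) = ennreal (D x a)"
    if "x \<ge> 0" "a \<ge> 0" for x a
    using nn_integral_affine_indicator[OF E that(1) _ that(2), of 1] by (simp add: D_def G_def)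
  have int\<sigma>: "(\<integral>\<^sup>+t. indicator E (x + \<sigma> * t) * indicator {0..real N * v} t \<partial>lborel) =
      ennreal (D x ((real N + 1) * v) / \<sigma>)" if "x \<ge> 0" for x
  proof -
    have "\<sigma> * (real N * v) = (real N + 1) * v" using Np by (simp add: \<sigma>_def)
    with nn_integral_affine_indicator[OF E that \<sigma>, of "real N * v"] v_nonneg show ?thesis
      unfolding D_def G_def by (simp del: mult_cancel_right)
  qed
  define a where "a k = y\<^sub>0 + real k * period" for k
  define z' where "z' k = real k * period + z" for k
  have pos: "a k \<ge> 0" "z' k \<ge> 0" "a k + h \<ge> 0" "z' k + g \<ge> 0" for k
    using period_pos y\<^sub>0_nonneg z_nonneg g_nonneg h_pos' by (simp_all add: a_def z'_def)
  have B2: "snd (B_seg k t) = a k + h + \<sigma> * t" and C1: "fst (C_seg k t) = a k + h + \<sigma> * t" for k t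
    using Np by (simp_all add: B_seg_def C_seg_def a_def \<sigma>_def field_simps)
  have B1: "fst (B_seg k t) = a k + t" and C2: "snd (C_seg k t) = a (Suc k) + t"
    and A1: "fst (A_seg k t) = z' k + t" and A2: "snd (A_seg k t) = z' k + g + t" for k t
    by (simp_all add: B_seg_def C_seg_def A_seg_def a_def z'_def algebra_simps)
  have ind: "(\<lambda>p. indicator (f -` E) p :: ennreal) = (\<lambda>p. indicator E (f p))" for f :: "real \<times> real \<Rightarrow> real"
    by (auto simp: indicator_def)
  have vm: "f -` E \<in> sets borel" if "f \<in> borel_measurable borel" for f :: "real \<times> real \<Rightarrow> real"
    using measurable_sets[OF that E] by simp
  have emb: "emeasure nu (f -` E) = (\<integral>\<^sup>+p. indicator E (f p) \<partial>nu)"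
    if "f \<in> borel_measurable borel" for f :: "real \<times> real \<Rightarrow> real"
    using vm[OF that] by (simp flip: ind)
  have c: "ennreal c * ennreal d = ennreal (c * d)" if "c \<ge> 0" "d \<ge> 0" for c d
    using that by (simp add: ennreal_mult)
  have Nv: "real N * v \<ge> 0" "(real N + 1) * v \<ge> 0" using v_nonneg by simp_all
  have S1: "emeasure nu (fst -` E) = ennreal ((\<Sum>k\<in>K. D (z' k) q) +
      (\<Sum>k<N. alpha_wt N k * D (a k) (real N * v)) +
      (\<Sum>k<N. beta_wt N k * (D (a k + h) ((real N + 1) * v) / \<sigma>)))"
  proof -
    have "emeasure nu (fst -` E) = (\<Sum>k\<in>K. ennreal (D (z' k) q)) +
      (\<Sum>k<N. ennreal (alpha_wt N k * D (a k) (real N * v))) +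
      (\<Sum>k<N. ennreal (beta_wt N k * (D (a k + h) ((real N + 1) * v) / \<sigma>)))"
      by (simp add: emb nn_integral_nu A1 B1 C1 int1 int\<sigma> pos q_nonneg Nv c wt_nonneg D \<sigma> less_imp_le)
    then show ?thesis
      by (simp add: alpha_sum_ennreal sum_nonneg wt_nonneg D q_nonneg Nv \<sigma> less_imp_le flip: ennreal_plus)
  qed
  have S2: "emeasure nu (snd -` E) = ennreal ((\<Sum>k\<in>K. D (z' k + g) q) +
      (\<Sum>k<N. alpha_wt N k * (D (a k + h) ((real N + 1) * v) / \<sigma>)) +
      (\<Sum>k<N. beta_wt N k * D (a (Suc k)) (real N * v)))"
  proof -
    have "emeasure nu (snd -` E) = (\<Sum>k\<in>K. ennreal (D (z' k + g) q)) +
      (\<Sum>k<N. ennreal (alpha_wt N k * (D (a k + h) ((real N + 1) * v) / \<sigma>))) +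
      (\<Sum>k<N. ennreal (beta_wt N k * D (a (Suc k)) (real N * v)))"
      by (simp add: emb nn_integral_nu A2 B2 C2 int1 int\<sigma> pos q_nonneg Nv c wt_nonneg D \<sigma> less_imp_le
        del: times_divide_eq_right)
    then show ?thesis
      by (simp add: alpha_sum_ennreal sum_nonneg wt_nonneg D q_nonneg Nv \<sigma> less_imp_le flip: ennreal_plus
        del: times_divide_eq_right)
  qed
  have b: "(\<Sum>k<N. alpha_wt N k * (D (a k + h) ((real N + 1) * v) / \<sigma>)) +
      (\<Sum>k<N. beta_wt N k * (D (a k + h) ((real N + 1) * v) / \<sigma>)) = (\<Sum>k<N. D (a k + h) ((real N + 1) * v))"
  proof -
    have "alpha_wt N k * (X / \<sigma>) + beta_wt N k * (X / \<sigma>) = X" for k X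
    proof -
      have "alpha_wt N k * (X / \<sigma>) + beta_wt N k * (X / \<sigma>) = \<sigma> * (X / \<sigma>)"
        using wt_add[OF N_pos, of k] by (simp only: \<sigma>_def distrib_right[symmetric])
      then show ?thesis using \<sigma> by simp
    qed
    then show ?thesis by (simp flip: sum.distrib)
  qed
  have nn: "0 \<le> (\<Sum>k\<in>K. D (z' k) q) + (\<Sum>k<N. alpha_wt N k * D (a k) (real N * v)) +
      (\<Sum>k<N. beta_wt N k * (D (a k + h) ((real N + 1) * v) / \<sigma>))"
    "0 \<le> (\<Sum>k\<in>K. D (z' k + g) q) + (\<Sum>k<N. alpha_wt N k * (D (a k + h) ((real N + 1) * v) / \<sigma>)) +
      (\<Sum>k<N. beta_wt N k * D (a (Suc k)) (real N * v))"
    by (intro add_nonneg_nonneg sum_nonneg mult_nonneg_nonneg divide_nonneg_pos D q_nonneg Nv \<sigma>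
        wt_nonneg; simp)+
  have "emeasure nu (fst -` E) + emeasure nu (snd -` E) = ennreal (
      (\<Sum>k\<in>K. D (z' k) q + D (z' k + g) q) +
      (\<Sum>k\<le>N. D (a k) (real N * v)) + (\<Sum>k<N. D (a k + h) ((real N + 1) * v)))"
    unfolding S1 S2 ennreal_plus[OF nn, symmetric] b[symmetric] sum.distrib
      sum_weighted_neighbours[OF N_pos, of "\<lambda>k. D (a k) (real N * v)", symmetric]
    by (rule arg_cong[of _ _ ennreal]) linarith
  also have "\<dots> = ennreal (G 1 - G 0)"
    unfolding D_def a_def z'_def by (rule arg_cong[of _ _ ennreal]) (rule tiling)
  also have "\<dots> = emeasure lborel (E \<inter> {0..1})"
    using emeasure_interval_mass[OF E, of 0 1] by (simp add: G_def)
  finally show ?thesis .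
qed

sublocale \<pi>: copula_measure \<pi>
proof
  fix E :: "real set" assume E: "E \<in> sets borel"
  have sw: "emeasure (distr nu borel prod.swap) F = emeasure nu (prod.swap -` F)" if "F \<in> sets borel" for F
    using that sets_eq_imp_space_eq[OF sets_nu] by (subst emeasure_distr) auto
  have vm: "fst -` E \<in> sets (borel :: (real \<times> real) measure)" "snd -` E \<in> sets (borel :: (real \<times> real) measure)"
    using measurable_sets[OF borel_measurable_fst_prod E] measurable_sets[OF borel_measurable_snd_prod E] by simp_all
  have swap: "prod.swap -` fst -` E = snd -` E" "prod.swap -` snd -` E = fst -` E" by auto
  show "emeasure \<pi> (fst -` E) = emeasure lborel (E \<inter> {0..1})"
    unfolding emeasure_\<pi>[OF vm(1)] sw[OF vm(1)] swap by (rule nu_margins[OF E])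
  show "emeasure \<pi> (snd -` E) = emeasure lborel (E \<inter> {0..1})"
    unfolding emeasure_\<pi>[OF vm(2)] sw[OF vm(2)] swap by (subst add.commute) (rule nu_margins[OF E])
qed simp

text \<open>The distance is \<open>g\<close> along \<open>A\<^sub>k\<close>, and it runs linearly through \<open>[h, h + v]\<close> along \<open>B\<^sub>k\<close> upwards
  and along \<open>C\<^sub>k\<close> downwards, which gives the same integral \<open>I\<close>; the weights of all these segments sum
  to \<open>N + 1\<close>.\<close>

lemma distance_moment:
  "(\<integral>p. \<bar>fst p - snd p\<bar> ^ j \<partial>\<pi>) =
     2 * (real (card K) * (g ^ j * q) + real N * (real N + 1) * (((h + v) ^ Suc j - h ^ Suc j) / real (Suc j)))"
proof -
  have Np: "real N > 0" using N_pos by simp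
  define I where "I = real N * (((h + v) ^ Suc j - h ^ Suc j) / real (Suc j))"
  have I_nonneg: "I \<ge> 0"
    unfolding I_def using h_pos' v_nonneg by (intro mult_nonneg_nonneg divide_nonneg_nonneg)
      (auto intro!: power_mono simp del: power_Suc)
  define f where "f p = ennreal (\<bar>fst p - snd p\<bar> ^ j)" for p :: "real \<times> real"
  have f [measurable]: "f \<in> borel_measurable borel"
    unfolding f_def by measurable
  have A: "(\<integral>\<^sup>+s. f (A_seg k s) * indicator {0..q} s \<partial>lborel) = ennreal (g ^ j * q)" for k
    using g_nonneg q_nonneg
    by (simp add: f_def A_seg_def nn_integral_cmult_indicator ennreal_mult)
  have B: "(\<integral>\<^sup>+t. f (B_seg k t) * indicator {0..real N * v} t \<partial>lborel) = ennreal I" for k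
  proof -
    have "\<bar>fst (B_seg k t) - snd (B_seg k t)\<bar> = h + (1 / real N) * t" if "0 \<le> t" for t
    proof -
      have "0 \<le> t / real N" using that by simp
      moreover have "snd (B_seg k t) - fst (B_seg k t) = h + t / real N"
        by (simp add: B_seg_def)
      ultimately show ?thesis using h_pos' by simp
    qed
    then have "(\<integral>\<^sup>+t. f (B_seg k t) * indicator {0..real N * v} t \<partial>lborel) =
        (\<integral>\<^sup>+t. ennreal ((h + (1 / real N) * t) ^ j) * indicator {0..real N * v} t \<partial>lborel)"
      by (intro nn_integral_cong) (auto simp: f_def indicator_def)
    also have "\<dots> = ennreal I"
      using Np h_pos' v_nonneg
      by (subst nn_integral_power_affine) (auto simp: I_def field_simps simp del: power_Suc)
    finally show ?thesis .
  qed
  have C: "(\<integral>\<^sup>+t. f (C_seg k t) * indicator {0..real N * v} t \<partial>lborel) = ennreal I" for k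
  proof -
    have "\<bar>fst (C_seg k t) - snd (C_seg k t)\<bar> = h + v + (- 1 / real N) * t"
      if "0 \<le> t" "t \<le> real N * v" for t
    proof -
      have "t / real N \<le> v" using that Np by (simp add: field_simps)
      moreover have "snd (C_seg k t) - fst (C_seg k t) = h + v - t / real N"
        by (simp add: C_seg_def period_def algebra_simps)
      ultimately show ?thesis using h_pos' by simp
    qed
    then have "(\<integral>\<^sup>+t. f (C_seg k t) * indicator {0..real N * v} t \<partial>lborel) =
        (\<integral>\<^sup>+t. ennreal ((h + v + (- 1 / real N) * t) ^ j) * indicator {0..real N * v} t \<partial>lborel)"
      by (intro nn_integral_cong) (auto simp: f_def indicator_def)
    also have "\<dots> = ennreal I"
      using Np h_pos' v_nonneg
      by (subst nn_integral_power_affine) (auto simp: I_def field_simps simp del: power_Suc)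
    finally show ?thesis .
  qed
  have w: "ennreal (alpha_wt N k) * ennreal I = ennreal (alpha_wt N k * I)" if "k < N" for k
    using that I_nonneg by (simp add: ennreal_mult wt_nonneg)
  have w': "ennreal (beta_wt N k) * ennreal I = ennreal (beta_wt N k * I)" for k
    using I_nonneg by (simp add: ennreal_mult wt_nonneg)
  have gq: "0 \<le> g ^ j * q" using g_nonneg q_nonneg by simp
  have "(\<integral>\<^sup>+p. f p \<partial>nu) = (\<Sum>k\<in>K. ennreal (g ^ j * q)) + (\<Sum>k<N. ennreal (alpha_wt N k * I)) +
      (\<Sum>k<N. ennreal (beta_wt N k * I))"
    by (simp add: nn_integral_nu A B C w w')
  also have "\<dots> = ennreal ((\<Sum>k\<in>K. g ^ j * q) + (\<Sum>k<N. alpha_wt N k * I) + (\<Sum>k<N. beta_wt N k * I))"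
    using gq I_nonneg by (simp add: alpha_sum_ennreal sum_nonneg wt_nonneg flip: ennreal_plus del: sum_constant)
  also have "(\<Sum>k\<in>K. g ^ j * q) + (\<Sum>k<N. alpha_wt N k * I) + (\<Sum>k<N. beta_wt N k * I) =
      real (card K) * (g ^ j * q) + (real N + 1) * I"
    using sum_weighted_neighbours[OF N_pos, of "\<lambda>_. I"] by (simp add: algebra_simps)
  finally have nu: "(\<integral>\<^sup>+p. f p \<partial>nu) = ennreal (real (card K) * (g ^ j * q) + (real N + 1) * I)" .
  have "f (prod.swap p) = f p" for p by (simp add: f_def abs_minus_commute)
  then have "(\<integral>\<^sup>+p. f p \<partial>\<pi>) = (\<integral>\<^sup>+p. f p \<partial>nu) + (\<integral>\<^sup>+p. f p \<partial>nu)"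
    by (simp add: nn_integral_\<pi>)
  also have "\<dots> = ennreal (2 * (real (card K) * (g ^ j * q) + (real N + 1) * I))"
    unfolding nu mult_2 using gq I_nonneg by (intro ennreal_plus[symmetric]) simp_all
  finally have "(\<integral>\<^sup>+p. ennreal (\<bar>fst p - snd p\<bar> ^ j) \<partial>\<pi>) =
      ennreal (2 * (real (card K) * (g ^ j * q) + (real N + 1) * I))"
    unfolding f_def .
  moreover have "0 \<le> 2 * (real (card K) * (g ^ j * q) + (real N + 1) * I)"
    using gq I_nonneg by simp
  ultimately have "(\<integral>p. \<bar>fst p - snd p\<bar> ^ j \<partial>\<pi>) = 2 * (real (card K) * (g ^ j * q) + (real N + 1) * I)"
    by (subst integral_eq_nn_integral) (simp_all only: enn2real_ennreal, auto)
  then show ?thesis by (simp add: I_def algebra_simps)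
qed

end

section \<open>The moments of the constructed couplings\<close>

lemma d_par_eq: "N \<ge> 1 \<Longrightarrow> d_par N = 2 * real N * (real N + 1)"
  by (simp add: d_par_def L_end_def R_end_def field_simps)

text \<open>The bound \<open>d\<^sub>N v \<le> 1\<close>, that is \<open>p \<ge> 0\<close>, is where it matters that \<open>\<Delta>\<close> is the distance to the
  nearer end point; the last two identities evaluate the moments.\<close>

lemma width_bounds:
  assumes N: "N \<ge> 1" and \<Delta>: "0 \<le> \<Delta>" "2 * \<Delta> \<le> L_end N - R_end N"
    and v: "v = sqrt (2 * \<Delta> / d_par N)"
  shows "0 \<le> v" "d_par N * v \<le> 1" "real N * (real N + 1) * v\<^sup>2 = \<Delta>"
    "\<Delta> * v = \<Delta> powr (3/2) / sqrt (real N * (real N + 1))"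
proof -
  have d: "d_par N > 0" using N by (simp add: d_par_eq)
  show v0: "0 \<le> v" using d \<Delta> by (simp add: v)
  have v2: "v\<^sup>2 = 2 * \<Delta> / d_par N" using d \<Delta> by (simp add: v)
  then show e: "real N * (real N + 1) * v\<^sup>2 = \<Delta>"
    using N by (simp add: d_par_eq)
  have "2 * \<Delta> \<le> 1 / d_par N" using \<Delta> by (simp add: d_par_def)
  then have "2 * \<Delta> * d_par N \<le> 1" using d by (simp add: field_simps)
  moreover have "(d_par N * v)\<^sup>2 = 2 * \<Delta> * d_par N"
    unfolding power_mult_distrib v2 using d by (simp add: power2_eq_square)
  ultimately have "(d_par N * v)\<^sup>2 \<le> 1\<^sup>2" by simp
  then show "d_par N * v \<le> 1" by (rule power2_le_imp_le) simp
  have "v = sqrt (\<Delta> / (real N * (real N + 1)))" using N by (simp add: v d_par_eq)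
  moreover have "\<Delta> powr (3/2) = \<Delta> * sqrt \<Delta>"
  proof -
    have "\<Delta> powr (1 + 1/2) = \<Delta> powr 1 * \<Delta> powr (1/2)" by (rule powr_add)
    then show ?thesis using \<Delta> by (simp add: powr_half_sqrt)
  qed
  ultimately show "\<Delta> * v = \<Delta> powr (3/2) / sqrt (real N * (real N + 1))"
    by (simp add: real_sqrt_divide)
qed

text \<open>What symmetry, optimality and uniqueness need of a coupling, detached from the parameters of the construction.\<close>

definition contact_witness :: "(real \<times> real) measure \<Rightarrow> bool" where
  "contact_witness \<pi> \<longleftrightarrow> copula_measure \<pi> \<and>
     (\<forall>E\<in>sets borel. emeasure \<pi> (prod.swap -` E) = emeasure \<pi> E) \<and>
     (\<exists>S \<theta>. half_shift S \<theta> \<and> (AE p in \<pi>. p \<in> half_shift.contact S))"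

text \<open>Here \<open>y\<^sub>0 = 0\<close>: the interval \<open>[0,1]\<close> begins and ends with a stretched piece, and \<open>A\<^sub>k\<close> leaves the
  translated piece that follows the \<open>k\<close>-th stretched one, with the larger displacement \<open>h + v = L\<close>. The total length is
  \<open>N \<theta> + N v = 2 N L = 1\<close>.\<close>

lemma pi_meas_left:
  assumes N: "N \<ge> 1" and x: "x \<in> I_left N"
  defines "m \<equiv> m_par x" and "\<Delta> \<equiv> L_end N - m_par x"
  shows "contact_witness (pi_meas x)"
    "(\<integral>p. \<bar>fst p - snd p\<bar> \<partial>pi_meas x) = m"
    "(\<integral>p. (fst p - snd p)\<^sup>2 \<partial>pi_meas x) =
       m\<^sup>2 - \<Delta>\<^sup>2 + 2/3 * (\<Delta> powr (3/2) / sqrt (real N * (real N + 1)))"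
proof -
  define L where "L = L_end N"
  define v where "v = v_left N x"
  define q where "q = p_left N x * L"
  have Np: "real N > 0" using N by simp
  have \<Delta>: "0 \<le> \<Delta>" "2 * \<Delta> \<le> L_end N - R_end N"
    using x by (auto simp: \<Delta>_def m_par_def I_left_def field_simps)
  have v_eq: "v = sqrt (2 * \<Delta> / d_par N)" by (simp add: v_def v_left_def \<Delta>_def)
  note wb = width_bounds[OF N \<Delta> v_eq]
  have L: "2 * real N * L = 1" "L > 0" using Np by (simp_all add: L_def L_end_def)
  have dL: "d_par N * L = real N + 1"
    using L(1) N by (simp add: d_par_eq algebra_simps)
  have "q = L - (d_par N * L) * v"
    by (simp add: q_def p_left_def v_def[symmetric] algebra_simps)
  then have q: "q = L - (real N + 1) * v" unfolding dL .
  then have Lq: "L = q + (real N + 1) * v" by simp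
  have "0 \<le> q"
    unfolding q_def p_left_def v_def[symmetric] using wb(2) L by (intro mult_nonneg_nonneg) auto
  have h_pos: "real N * v + q > 0"
  proof (cases "v = 0")
    case True
    then show ?thesis using L q by simp
  next
    case False
    then have "real N * v > 0" using wb(1) Np by simp
    then show ?thesis using \<open>0 \<le> q\<close> by simp
  qed
  interpret Z: zigzag N q v 0
    by unfold_locales (use N wb \<open>0 \<le> q\<close> h_pos in auto)
  have h: "Z.h = L - v" and period: "Z.period = 2 * L - v"
    by (simp_all add: Z.h_def Z.period_def Lq algebra_simps)
  interpret chain N q v 0 "{..<N}" "real N * v" L
  proof
    show "Z.zigzag_shift (real k * Z.period + real N * v + s) = real k * Z.period + real N * v + s + L"
      if "k \<in> {..<N}" "0 \<le> s" "s \<le> q" for k s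
      using Z.shift_low[of "real N * v + s" "int k"] that wb(1) Np
      by (simp add: Z.h_def add.assoc) (simp add: Lq algebra_simps)
    fix G :: "real \<Rightarrow> real"
    have "(\<Sum>k<N. G (real k * Z.period + real N * v + q) - G (real k * Z.period + real N * v) +
             (G (real k * Z.period + real N * v + L + q) - G (real k * Z.period + real N * v + L))) +
        (\<Sum>k<N. G (0 + real k * Z.period + real N * v) - G (0 + real k * Z.period)) +
        (\<Sum>k<N. G (0 + real k * Z.period + Z.h + (real N + 1) * v) - G (0 + real k * Z.period + Z.h)) =
      (\<Sum>k<N. G (real (Suc k) * Z.period) - G (real k * Z.period))"
      unfolding sum.distrib[symmetric]
    proof (rule sum.cong[OF refl])
      fix k
      have e: "real k * Z.period + real N * v + q = 0 + real k * Z.period + Z.h"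
        "real k * Z.period + real N * v + L = 0 + real k * Z.period + Z.h + (real N + 1) * v"
        "real k * Z.period + real N * v + L + q = real (Suc k) * Z.period"
        by (simp_all add: h period Lq algebra_simps)
      show "G (real k * Z.period + real N * v + q) - G (real k * Z.period + real N * v) +
             (G (real k * Z.period + real N * v + L + q) - G (real k * Z.period + real N * v + L)) +
          (G (0 + real k * Z.period + real N * v) - G (0 + real k * Z.period)) +
          (G (0 + real k * Z.period + Z.h + (real N + 1) * v) - G (0 + real k * Z.period + Z.h)) =
        G (real (Suc k) * Z.period) - G (real k * Z.period)"
        unfolding e(3) unfolding e(1,2) by simp
    qed
    also have "\<dots> = G (real N * Z.period) - G 0"
      using sum_lessThan_telescope[of "\<lambda>k. G (real k * Z.period)" N] by simp
    moreover have "real N * Z.period + real N * v = 1"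
      using L(1) by (simp add: period algebra_simps)
    ultimately show "(\<Sum>k<N. G (real k * Z.period + real N * v + q) - G (real k * Z.period + real N * v) +
             (G (real k * Z.period + real N * v + L + q) - G (real k * Z.period + real N * v + L))) +
        (\<Sum>k\<le>N. G (0 + real k * Z.period + real N * v) - G (0 + real k * Z.period)) +
        (\<Sum>k<N. G (0 + real k * Z.period + Z.h + (real N + 1) * v) - G (0 + real k * Z.period + Z.h)) =
      G 1 - G 0"
      by (simp add: lessThan_Suc_atMost[symmetric])
  qed (use L wb in auto)
  have seg: "A_left N x k = A_seg k" "B_left N x k = B_seg k" "C_left N x k = C_seg k" for k
    by (auto simp: A_left_def A_seg_def B_left_def B_seg_def C_left_def C_seg_def ell_left_def
        theta_left_def v_def[symmetric] L_def[symmetric] h period)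
  have "nu_left N x = nu"
    by (simp add: nu_left_def nu_def seg v_def[symmetric] L_def[symmetric] q_def[symmetric])
  moreover have "nu_meas x = nu_left N x"
    using x N_of_eq[OF N] I_int_Un(1)[OF N] by (auto simp: nu_meas_def)
  ultimately have pi: "pi_meas x = \<pi>"
    by (simp add: pi_meas_def \<pi>_def)
  show "contact_witness (pi_meas x)"
    unfolding pi contact_witness_def
    using \<pi>.copula_measure_axioms \<pi>_symmetric AE_\<pi>_contact Z.half_shift_axioms by blast
  have mL: "m = L - \<Delta>" by (simp add: \<Delta>_def m_def L_def)
  have hv: "Z.h + v = L" by (simp add: h)
  have "(\<integral>p. \<bar>fst p - snd p\<bar> \<partial>\<pi>) = 2 * (real N * (L * q) + real N * (real N + 1) * ((L\<^sup>2 - (L - v)\<^sup>2) / 2))"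
    using distance_moment[of 1] by (simp add: h power2_eq_square)
  also have "\<dots> = (2 * real N * L) * L - real N * (real N + 1) * v\<^sup>2"
    by (simp add: q power2_eq_square field_simps)
  finally show "(\<integral>p. \<bar>fst p - snd p\<bar> \<partial>pi_meas x) = m"
    by (simp add: pi wb(3) L(1) mL)
  have "(\<integral>p. (fst p - snd p)\<^sup>2 \<partial>\<pi>) = 2 * (real N * (L\<^sup>2 * q) + real N * (real N + 1) * ((L ^ 3 - (L - v) ^ 3) / 3))"
    using distance_moment[of 2] by (simp add: h power3_eq_cube power2_eq_square)
  also have "\<dots> = (2 * real N * L) * L\<^sup>2 - 2 * L * (real N * (real N + 1) * v\<^sup>2) +
      2 / 3 * ((real N * (real N + 1) * v\<^sup>2) * v)"
    by (simp add: q power2_eq_square power3_eq_cube field_simps)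
  also have "\<dots> = m\<^sup>2 - \<Delta>\<^sup>2 + 2 / 3 * (\<Delta> * v)"
    unfolding L(1) wb(3) by (simp add: mL power2_eq_square field_simps)
  finally show "(\<integral>p. (fst p - snd p)\<^sup>2 \<partial>pi_meas x) =
       m\<^sup>2 - \<Delta>\<^sup>2 + 2/3 * (\<Delta> powr (3/2) / sqrt (real N * (real N + 1)))"
    unfolding pi wb(4) .
qed

text \<open>Here \<open>y\<^sub>0 = q\<close>: the interval \<open>[0,1]\<close> begins and ends with a translated piece, and \<open>A\<^sub>k\<close> leaves the
  last piece of the period before \<open>y\<^sub>0 + k \<theta>\<close>, with the smaller displacement \<open>h = R\<close>. The total length
  is \<open>N \<theta> + R + q = 2 (N + 1) R = 1\<close>.\<close>

lemma pi_meas_right: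
  assumes N: "N \<ge> 1" and x: "x \<in> I_right N"
  defines "m \<equiv> m_par x" and "\<Delta> \<equiv> m_par x - R_end N"
  shows "contact_witness (pi_meas x)"
    "(\<integral>p. \<bar>fst p - snd p\<bar> \<partial>pi_meas x) = m"
    "(\<integral>p. (fst p - snd p)\<^sup>2 \<partial>pi_meas x) =
       m\<^sup>2 - \<Delta>\<^sup>2 + 2/3 * (\<Delta> powr (3/2) / sqrt (real N * (real N + 1)))"
proof -
  define R where "R = R_end N"
  define v where "v = v_right N x"
  define q where "q = p_right N x * R"
  have Np: "real N > 0" using N by simp
  have \<Delta>: "0 \<le> \<Delta>" "2 * \<Delta> \<le> L_end N - R_end N"
    using x by (auto simp: \<Delta>_def m_par_def I_right_def field_simps)
  have v_eq: "v = sqrt (2 * \<Delta> / d_par N)" by (simp add: v_def v_right_def \<Delta>_def)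
  note wb = width_bounds[OF N \<Delta> v_eq]
  have R: "2 * (real N + 1) * R = 1" "R > 0" using Np by (simp_all add: R_def R_end_def)
  have "d_par N * R = real N * (2 * (real N + 1) * R)"
    by (simp add: d_par_eq[OF N] algebra_simps)
  then have dR: "d_par N * R = real N" by (simp only: R(1) mult_1_right)
  have "q = R - (d_par N * R) * v"
    by (simp add: q_def p_right_def v_def[symmetric] algebra_simps)
  then have q: "q = R - real N * v" unfolding dR .
  then have Rq: "R = q + real N * v" by simp
  have "0 \<le> q"
    unfolding q_def p_right_def v_def[symmetric] using wb(2) R by (intro mult_nonneg_nonneg) auto
  interpret Z: zigzag N q v q
    by unfold_locales (use N wb \<open>0 \<le> q\<close> R q in auto)
  have h: "Z.h = R" and period: "Z.period = 2 * R + v"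
    by (simp_all add: Z.h_def Z.period_def Rq)
  interpret chain N q v q "{..N}" 0 R
  proof
    show "Z.zigzag_shift (real k * Z.period + 0 + s) = real k * Z.period + 0 + s + R"
      if "k \<in> {..N}" and s: "0 \<le> s" "s \<le> q" for k s
    proof -
      \<comment> \<open>Measured from \<open>y\<^sub>0 = q\<close>, the segment starts at the end of the period with number \<open>k - 1\<close>, which is \<open>-1\<close> for \<open>k = 0\<close>.\<close>
      have e: "q + real_of_int (int k - 1) * Z.period + (Z.period - q + s) = real k * Z.period + 0 + s"
        by (simp add: algebra_simps)
      have r: "Z.period - q + s - Z.h - v = real N * v + s"
        "Z.period - q + s - Z.h = real N * v + v + s"
        by (simp_all add: h period Rq)
      have "(real N * v + v + s) * real N = (real N + 1) * (real N * v) + real N * s"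
        by (simp add: algebra_simps)
      also have "\<dots> \<le> (real N + 1) * (real N * v) + (real N + 1) * s"
        using s by (intro add_left_mono mult_right_mono) auto
      also have "\<dots> = (real N * v + s) * (real N + 1)"
        by (simp add: algebra_simps)
      finally have "(real N * v + v + s) * (real N / (real N + 1)) \<le> real N * v + s"
        by (simp add: pos_divide_le_eq)
      then have "max ((Z.period - q + s - Z.h) * (real N / (real N + 1))) (Z.period - q + s - Z.h - v) = real N * v + s"
        unfolding r by (simp add: max_def)
      moreover have "Z.h \<le> Z.period - q + s" "Z.period - q + s \<le> Z.period"
        using s wb(1) Np by (simp_all add: h period Rq)
      ultimately have "Z.zigzag_shift (real k * Z.period + 0 + s) = q + real k * Z.period + (real N * v + s)"
        using Z.shift_high[of "Z.period - q + s" "int k - 1"] unfolding e by simp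
      then show ?thesis by (simp add: Rq)
    qed
    fix G :: "real \<Rightarrow> real"
    let ?X = "\<lambda>k. G (real k * Z.period + 0 + q) - G (real k * Z.period + 0) +
             (G (real k * Z.period + 0 + R + q) - G (real k * Z.period + 0 + R)) +
        (G (q + real k * Z.period + real N * v) - G (q + real k * Z.period))"
    have X: "?X k = G (real k * Z.period + R + q) - G (real k * Z.period)" for k
    proof -
      have "q + real k * Z.period + real N * v = real k * Z.period + 0 + R" by (simp add: Rq)
      moreover have "q + real k * Z.period = real k * Z.period + 0 + q" by simp
      ultimately show ?thesis by (simp only: add_0_right)
    qed
    have Y: "G (q + real k * Z.period + Z.h + (real N + 1) * v) - G (q + real k * Z.period + Z.h) =
        G (real (Suc k) * Z.period) - G (real k * Z.period + R + q)" for k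
    proof -
      have "q + real k * Z.period + Z.h + (real N + 1) * v = real (Suc k) * Z.period"
        "q + real k * Z.period + Z.h = real k * Z.period + R + q"
        by (simp_all add: h period Rq algebra_simps)
      then show ?thesis by (simp only:)
    qed
    have "(\<Sum>k\<le>N. G (real k * Z.period + 0 + q) - G (real k * Z.period + 0) +
             (G (real k * Z.period + 0 + R + q) - G (real k * Z.period + 0 + R))) +
        (\<Sum>k\<le>N. G (q + real k * Z.period + real N * v) - G (q + real k * Z.period)) +
        (\<Sum>k<N. G (q + real k * Z.period + Z.h + (real N + 1) * v) - G (q + real k * Z.period + Z.h)) =
      (\<Sum>k\<le>N. G (real k * Z.period + R + q) - G (real k * Z.period)) +
      (\<Sum>k<N. G (real (Suc k) * Z.period) - G (real k * Z.period + R + q))"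
      unfolding sum.distrib[symmetric] X Y ..
    also have "\<dots> = (\<Sum>k<N. G (real (Suc k) * Z.period) - G (real k * Z.period)) +
        (G (real N * Z.period + R + q) - G (real N * Z.period))"
      by (simp add: lessThan_Suc_atMost[symmetric] sum.distrib[symmetric])
    also have "(\<Sum>k<N. G (real (Suc k) * Z.period) - G (real k * Z.period)) = G (real N * Z.period) - G 0"
      using sum_lessThan_telescope[of "\<lambda>k. G (real k * Z.period)" N] by simp
    also have "real N * Z.period + R + q = 1"
      using R(1) by (simp add: period Rq algebra_simps)
    finally show "(\<Sum>k\<le>N. G (real k * Z.period + 0 + q) - G (real k * Z.period + 0) +
             (G (real k * Z.period + 0 + R + q) - G (real k * Z.period + 0 + R))) +
        (\<Sum>k\<le>N. G (q + real k * Z.period + real N * v) - G (q + real k * Z.period)) +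
        (\<Sum>k<N. G (q + real k * Z.period + Z.h + (real N + 1) * v) - G (q + real k * Z.period + Z.h)) =
      G 1 - G 0" by simp
  qed (use R wb \<open>0 \<le> q\<close> in auto)
  have seg: "A_right N x k = A_seg k" "B_right N x k = B_seg k" "C_right N x k = C_seg k" for k
    by (auto simp: A_right_def A_seg_def B_right_def B_seg_def C_right_def C_seg_def ell_right_def
        theta_right_def v_def[symmetric] R_def[symmetric] q_def[symmetric] h period)
  have "nu_right N x = nu"
    by (simp add: nu_right_def nu_def seg v_def[symmetric] R_def[symmetric] q_def[symmetric])
  moreover have "nu_meas x = nu_right N x"
    using x N_of_eq[OF N] I_int_Un[OF N] by (auto simp: nu_meas_def)
  ultimately have pi: "pi_meas x = \<pi>"
    by (simp add: pi_meas_def \<pi>_def)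
  show "contact_witness (pi_meas x)"
    unfolding pi contact_witness_def
    using \<pi>.copula_measure_axioms \<pi>_symmetric AE_\<pi>_contact Z.half_shift_axioms by blast
  have mR: "m = R + \<Delta>" by (simp add: \<Delta>_def m_def R_def)
  have "(\<integral>p. \<bar>fst p - snd p\<bar> \<partial>\<pi>) = 2 * ((real N + 1) * (R * q) + real N * (real N + 1) * (((R + v)\<^sup>2 - R\<^sup>2) / 2))"
    using distance_moment[of 1] by (simp add: h power2_eq_square add.commute)
  also have "\<dots> = (2 * (real N + 1) * R) * R + real N * (real N + 1) * v\<^sup>2"
    by (simp add: q power2_eq_square field_simps)
  finally show "(\<integral>p. \<bar>fst p - snd p\<bar> \<partial>pi_meas x) = m"
    by (simp only: pi wb(3) R(1) mR mult_1_left)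
  have "(\<integral>p. (fst p - snd p)\<^sup>2 \<partial>\<pi>) = 2 * ((real N + 1) * (R\<^sup>2 * q) + real N * (real N + 1) * (((R + v) ^ 3 - R ^ 3) / 3))"
    using distance_moment[of 2] by (simp add: h power3_eq_cube power2_eq_square add.commute)
  also have "\<dots> = (2 * (real N + 1) * R) * R\<^sup>2 + 2 * R * (real N * (real N + 1) * v\<^sup>2) +
      2 / 3 * ((real N * (real N + 1) * v\<^sup>2) * v)"
    by (simp add: q power2_eq_square power3_eq_cube field_simps)
  also have "\<dots> = m\<^sup>2 - \<Delta>\<^sup>2 + 2 / 3 * (\<Delta> * v)"
    unfolding R(1) wb(3) by (simp add: mR power2_eq_square field_simps)
  finally show "(\<integral>p. (fst p - snd p)\<^sup>2 \<partial>pi_meas x) =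
       m\<^sup>2 - \<Delta>\<^sup>2 + 2/3 * (\<Delta> powr (3/2) / sqrt (real N * (real N + 1)))"
    unfolding pi wb(4) .
qed

section \<open>The maximal value of Spearman's rho\<close>

lemma opt_copula_measure:
  assumes "N \<ge> 1" "x \<in> I_int N"
  shows "x < 1" "opt_copula x u v = measure (pi_meas x) ({0..u} \<times> {0..v})"
proof -
  have "0 < 3 / (2 * real N + 2)" by simp
  moreover have "x < 1 - 3 / (2 * real N + 2)" using assms by (simp add: I_int_def)
  ultimately show "x < 1" by linarith
  then show "opt_copula x u v = measure (pi_meas x) ({0..u} \<times> {0..v})"
    by (simp add: opt_copula_def)
qed

text \<open>The moments depend on the chosen end point only through its distance \<open>\<Delta>\<close> to \<open>m\<close>, so at the midpoint
  both choices give the same value.\<close>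

lemma pi_meas_moments:
  assumes N: "N \<ge> 1" and x: "x \<in> I_int N"
    and l: "l \<in> {1 / (2 * real N), 1 / (2 * real N + 2)}"
    and near: "\<forall>e\<in>{1 / (2 * real N), 1 / (2 * real N + 2)}. \<bar>m_par x - l\<bar> \<le> \<bar>m_par x - e\<bar>"
  defines "\<Delta> \<equiv> \<bar>m_par x - l\<bar>"
  shows "contact_witness (pi_meas x)"
    "(\<integral>p. \<bar>fst p - snd p\<bar> \<partial>pi_meas x) = m_par x"
    "(\<integral>p. (fst p - snd p)\<^sup>2 \<partial>pi_meas x) =
       (m_par x)\<^sup>2 - \<Delta>\<^sup>2 + 2/3 * (\<Delta> powr (3/2) / sqrt (real N * (real N + 1)))"
proof -
  have LR: "L_end N = 1 / (2 * real N)" "R_end N = 1 / (2 * real N + 2)"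
    by (simp_all add: L_end_def R_end_def)
  have near': "\<Delta> \<le> \<bar>m_par x - L_end N\<bar>" "\<Delta> \<le> \<bar>m_par x - R_end N\<bar>"
    "\<Delta> = \<bar>m_par x - L_end N\<bar> \<or> \<Delta> = \<bar>m_par x - R_end N\<bar>"
    using near l by (auto simp: \<Delta>_def LR)
  have "contact_witness (pi_meas x) \<and>
    (\<integral>p. \<bar>fst p - snd p\<bar> \<partial>pi_meas x) = m_par x \<and>
    (\<integral>p. (fst p - snd p)\<^sup>2 \<partial>pi_meas x) =
       (m_par x)\<^sup>2 - \<Delta>\<^sup>2 + 2/3 * (\<Delta> powr (3/2) / sqrt (real N * (real N + 1)))"
  proof (cases "x \<in> I_left N")
    case True
    then have "L_end N - m_par x < m_par x - R_end N" "0 \<le> L_end N - m_par x"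
      by (auto simp: I_left_def m_par_def field_simps)
    then have "\<Delta> = L_end N - m_par x" using near' by linarith
    with pi_meas_left[OF N True] show ?thesis by simp
  next
    case False
    with x I_int_Un(1)[OF N] have R: "x \<in> I_right N" by auto
    then have "m_par x - R_end N \<le> L_end N - m_par x" "0 \<le> m_par x - R_end N"
      by (auto simp: I_right_def m_par_def field_simps)
    then have "\<Delta> = m_par x - R_end N" using near' by linarith
    with pi_meas_right[OF N R] show ?thesis by simp
  qed
  then show "contact_witness (pi_meas x)"
    "(\<integral>p. \<bar>fst p - snd p\<bar> \<partial>pi_meas x) = m_par x"
    "(\<integral>p. (fst p - snd p)\<^sup>2 \<partial>pi_meas x) =
       (m_par x)\<^sup>2 - \<Delta>\<^sup>2 + 2/3 * (\<Delta> powr (3/2) / sqrt (real N * (real N + 1)))"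
    by simp_all
qed

lemma opt_copula_optimal:
  assumes N: "N \<ge> 1" and x: "x \<in> I_int N"
  shows "symmetric_copula (opt_copula x)" "footrule (opt_copula x) = x"
    and "is_copula D \<Longrightarrow> footrule D = x \<Longrightarrow> spearman_rho D \<le> spearman_rho (opt_copula x)"
    and "is_copula D \<Longrightarrow> footrule D = x \<Longrightarrow> spearman_rho D = spearman_rho (opt_copula x) \<Longrightarrow>
      copula_eq D (opt_copula x)"
    and "spearman_rho (opt_copula x) = 1 - 6 * (\<integral>p. (fst p - snd p)\<^sup>2 \<partial>pi_meas x)"
proof -
  obtain l where "l \<in> {1 / (2 * real N), 1 / (2 * real N + 2)}"
    "\<forall>e\<in>{1 / (2 * real N), 1 / (2 * real N + 2)}. \<bar>m_par x - l\<bar> \<le> \<bar>m_par x - e\<bar>"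
    by (metis (no_types, lifting) insert_iff linorder_le_cases order_refl singletonD)
  note ch = pi_meas_moments[OF N x this]
  obtain S \<theta> where S: "half_shift S \<theta>" "AE p in pi_meas x. p \<in> half_shift.contact S"
    and pi: "copula_measure (pi_meas x)"
    and sym: "\<And>E. E \<in> sets borel \<Longrightarrow> emeasure (pi_meas x) (prod.swap -` E) = emeasure (pi_meas x) E"
    using ch(1) unfolding contact_witness_def by blast
  note C = opt_copula_measure(2)[OF N x]
  show foot: "footrule (opt_copula x) = x"
    using copula_measure.footrule_eq[OF pi C] ch(2) by (simp add: m_par_def field_simps)
  show "spearman_rho (opt_copula x) = 1 - 6 * (\<integral>p. (fst p - snd p)\<^sup>2 \<partial>pi_meas x)"
    by (rule copula_measure.spearman_rho_eq[OF pi C])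
  have "is_copula (opt_copula x)"
    unfolding is_copula_iff using pi C by blast
  moreover have "opt_copula x u v = opt_copula x v u" for u v
  proof -
    have "{0..u} \<times> {0..v} \<in> sets borel"
      by (intro borel_closed closed_Times) auto
    moreover have "prod.swap -` ({0..u} \<times> {0..v}) = {0..v} \<times> {0..u}" by auto
    ultimately show ?thesis using sym[of "{0..u} \<times> {0..v}"] by (simp add: C measure_def)
  qed
  ultimately show "symmetric_copula (opt_copula x)"
    by (simp add: symmetric_copula_def)
  show "spearman_rho D \<le> spearman_rho (opt_copula x)" if "is_copula D" "footrule D = x"
    using half_shift.contact_copula_optimal(1)[OF S(1) pi S(2) C that(1)] that(2) foot by simp
  show "copula_eq D (opt_copula x)" if "is_copula D" "footrule D = x" "spearman_rho D = spearman_rho (opt_copula x)"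
    using half_shift.contact_copula_optimal(2)[OF S(1) pi S(2) C that(1)] that foot by simp
qed

lemma rho_bar_eq_maximizer:
  assumes "is_rho_maximizer x C"
  shows "rho_bar x = spearman_rho C"
  using assms unfolding rho_bar_def is_rho_maximizer_def
  by (intro Greatest_equality) blast+

text \<open>Both \<open>E (U - V)\<^sup>2 = 0\<close> and \<open>E \<bar>U - V\<bar> = 0\<close> mean \<open>U = V\<close> almost surely.\<close>

lemma upper_Frechet:
  shows "is_copula (opt_copula 1)" "footrule (opt_copula 1) = 1" "spearman_rho (opt_copula 1) = 1"
    and "is_copula D \<Longrightarrow> spearman_rho D \<le> 1"
    and "is_copula D \<Longrightarrow> footrule D = 1 \<Longrightarrow> copula_eq D (opt_copula 1)"
proof -
  define \<mu> where "\<mu> = distr (density lborel (indicator {0..1})) borel (\<lambda>t::real. (t, t))"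
  have diag [measurable]: "(\<lambda>t::real. (t, t)) \<in> borel_measurable borel"
    by (intro borel_measurable_continuous_onI continuous_intros)
  have em: "emeasure \<mu> E = emeasure lborel ({t. (t, t) \<in> E} \<inter> {0..1})" if E: "E \<in> sets borel" for E
  proof -
    have m [measurable]: "{t. (t, t) \<in> E} \<in> sets borel"
      using measurable_sets[OF diag E] by (simp add: vimage_def)
    have "emeasure \<mu> E = emeasure (density lborel (indicator {0..1})) {t. (t, t) \<in> E}"
      unfolding \<mu>_def using E by (subst emeasure_distr) (auto simp: vimage_def)
    then show ?thesis
      by (simp add: emeasure_density indicator_inter_arith[symmetric] Int_commute)
  qed
  have \<mu>: "copula_measure \<mu>"
  proof
    show "sets \<mu> = sets borel" by (simp add: \<mu>_def)
    fix E :: "real set" assume E: "E \<in> sets borel"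
    have "fst -` E \<in> sets (borel :: (real \<times> real) measure)" "snd -` E \<in> sets (borel :: (real \<times> real) measure)"
      using measurable_sets[OF borel_measurable_fst_prod E] measurable_sets[OF borel_measurable_snd_prod E] by simp_all
    from this[THEN em] show "emeasure \<mu> (fst -` E) = emeasure lborel (E \<inter> {0..1})"
      "emeasure \<mu> (snd -` E) = emeasure lborel (E \<inter> {0..1})" by auto
  qed
  have C: "opt_copula 1 u v = measure \<mu> ({0..u} \<times> {0..v})" if "u \<in> {0..1}" "v \<in> {0..1}" for u v
  proof -
    have "{t. (t, t) \<in> {0..u} \<times> {0..v}} \<inter> {0..1} = {0..min u v}" using that by auto
    moreover have "{0..u} \<times> {0..v} \<in> sets borel"
      by (intro borel_closed closed_Times) auto
    ultimately show ?thesis using that by (simp add: opt_copula_def em measure_def)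
  qed
  have AE: "AE p in \<mu>. fst p = snd p"
    unfolding \<mu>_def by (subst AE_distr_iff) auto
  show "is_copula (opt_copula 1)" unfolding is_copula_iff using \<mu> C by blast
  have "(\<integral>p. \<bar>fst p - snd p\<bar> \<partial>\<mu>) = 0" "(\<integral>p. (fst p - snd p)\<^sup>2 \<partial>\<mu>) = 0"
    by (rule integral_eq_zero_AE, use AE in \<open>eventually_elim, simp\<close>)+
  then show "footrule (opt_copula 1) = 1" "spearman_rho (opt_copula 1) = 1"
    using copula_measure.footrule_eq[OF \<mu> C] copula_measure.spearman_rho_eq[OF \<mu> C] by simp_all
  assume "is_copula D"
  then obtain \<nu> where \<nu>: "copula_measure \<nu>"
    and D: "\<And>u v. u \<in> {0..1} \<Longrightarrow> v \<in> {0..1} \<Longrightarrow> D u v = measure \<nu> ({0..u} \<times> {0..v})"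
    unfolding is_copula_iff by blast
  interpret copula_measure \<nu> by fact
  show "spearman_rho D \<le> 1"
    using spearman_rho_eq[OF D] by simp
  assume "footrule D = 1"
  then have "(\<integral>p. \<bar>fst p - snd p\<bar> \<partial>\<nu>) = 0" using footrule_eq[OF D] by simp
  then have AE\<nu>: "AE p in \<nu>. fst p = snd p"
    using integral_nonneg_eq_0_iff_AE[of \<nu> "\<lambda>p. \<bar>fst p - snd p\<bar>"]
    by (simp add: integrable_continuous continuous_intros)
  show "copula_eq D (opt_copula 1)"
    unfolding copula_eq_def
  proof (intro ballI)
    fix u v :: real assume uv: "u \<in> {0..1}" "v \<in> {0..1}"
    have "emeasure \<nu> ({0..u} \<times> {0..v}) = emeasure \<nu> (fst -` {0..min u v})"
    proof (rule emeasure_eq_AE)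
      show "AE p in \<nu>. p \<in> {0..u} \<times> {0..v} \<longleftrightarrow> p \<in> fst -` {0..min u v}"
        using AE\<nu> by eventually_elim (auto simp: mem_Times_iff)
      show "fst -` {0..min u v} \<in> sets \<nu>"
        using measurable_sets[of fst \<nu> borel "{0..min u v}"] by simp
      show "{0..u} \<times> {0..v} \<in> sets \<nu>" by (simp add: borel_closed closed_Times)
    qed
    also have "\<dots> = emeasure lborel ({0..min u v} \<inter> {0..1})"
      by (rule margin_fst) simp
    also have "{0..min u v} \<inter> {0..1} = {0..min u v}" using uv by auto
    finally show "D u v = opt_copula 1 u v"
      using uv by (simp add: D measure_def opt_copula_def)
  qed
qed

theorem theorem1p1:
  shows
    "(\<forall>x\<in>{-1/2..1::real}. \<exists>C. is_rho_maximizer x C \<and> spearman_rho C = rho_bar x)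
   \<and> (\<forall>(N::nat) (x::real). N \<ge> 1 \<longrightarrow> x \<in> I_int N \<longrightarrow>
        m_par x \<in> {1 / (2 * real N + 2) .. 1 / (2 * real N)}
      \<and> (\<forall>\<l>::real.
            \<l> \<in> {1 / (2 * real N), 1 / (2 * real N + 2)} \<longrightarrow>
            (\<forall>e\<in>{1 / (2 * real N), 1 / (2 * real N + 2)}. \<bar>m_par x - \<l>\<bar> \<le> \<bar>m_par x - e\<bar>) \<longrightarrow>
            (let m = m_par x; \<Delta> = \<bar>m - \<l>\<bar> in
               rho_bar x = 1 - 6 * \<l> * (2 * m - \<l>)
                             - 4 * \<Delta> powr (3/2) / sqrt (real N * (real N + 1))
             \<and> rho_bar x = u_bound x
                             - (4 * \<Delta> powr (3/2) / sqrt (real N * (real N + 1)) - 6 * \<Delta>\<^sup>2)))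
      \<and> symmetric_copula (opt_copula x)
      \<and> spearman_rho (opt_copula x) = rho_bar x
      \<and> footrule (opt_copula x) = x
      \<and> (\<forall>D. is_copula D \<and> spearman_rho D = rho_bar x \<and> footrule D = x
              \<longrightarrow> copula_eq D (opt_copula x)))
   \<and> rho_bar 1 = 1
   \<and> is_copula (opt_copula 1)
   \<and> spearman_rho (opt_copula 1) = rho_bar 1
   \<and> footrule (opt_copula 1) = 1
   \<and> (\<forall>D. is_copula D \<and> spearman_rho D = rho_bar 1 \<and> footrule D = 1
            \<longrightarrow> copula_eq D (opt_copula 1))"
proof -
  have max: "is_rho_maximizer x (opt_copula x)" if "N \<ge> 1" "x \<in> I_int N" for N x
    using opt_copula_optimal[OF that] by (simp add: is_rho_maximizer_def symmetric_copula_def)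
  have max1: "is_rho_maximizer 1 (opt_copula 1)"
    using upper_Frechet by (simp add: is_rho_maximizer_def)
  have exists: "\<exists>C. is_rho_maximizer x C \<and> spearman_rho C = rho_bar x" if "x \<in> {-1/2..1}" for x
  proof (cases "x = 1")
    case True
    then show ?thesis using max1 rho_bar_eq_maximizer by metis
  next
    case False
    with that have "-1/2 \<le> x" "x < 1" by auto
    then obtain N where "N \<ge> 1" "x \<in> I_int N" using ex1_I_int by blast
    then show ?thesis using max rho_bar_eq_maximizer by metis
  qed
  have m: "m_par x \<in> {1 / (2 * real N + 2) .. 1 / (2 * real N)}" if "N \<ge> 1" "x \<in> I_int N" for N x
    using that by (auto simp: I_int_def m_par_def)
  have formula: "rho_bar x = 1 - 6 * l * (2 * m_par x - l)
        - 4 * \<bar>m_par x - l\<bar> powr (3/2) / sqrt (real N * (real N + 1))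
      \<and> rho_bar x = u_bound x
        - (4 * \<bar>m_par x - l\<bar> powr (3/2) / sqrt (real N * (real N + 1)) - 6 * \<bar>m_par x - l\<bar>\<^sup>2)"
    if N: "N \<ge> 1" and x: "x \<in> I_int N" and l: "l \<in> {1 / (2 * real N), 1 / (2 * real N + 2)}"
      "\<forall>e\<in>{1 / (2 * real N), 1 / (2 * real N + 2)}. \<bar>m_par x - l\<bar> \<le> \<bar>m_par x - e\<bar>" for N x l
  proof -
    define w where "w = \<bar>m_par x - l\<bar> powr (3/2) / sqrt (real N * (real N + 1))"
    have "rho_bar x = 1 - 6 * ((m_par x)\<^sup>2 - \<bar>m_par x - l\<bar>\<^sup>2 + 2/3 * w)"
      using rho_bar_eq_maximizer[OF max[OF N x]] opt_copula_optimal(5)[OF N x]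
        pi_meas_moments(3)[OF N x l] by (simp add: w_def)
    then have r: "rho_bar x = 1 - 6 * (m_par x)\<^sup>2 + 6 * (m_par x - l)\<^sup>2 - 4 * w"
      by simp
    have "u_bound x = 1 - 6 * (m_par x)\<^sup>2"
      by (simp add: u_bound_def m_par_def power_divide)
    moreover have "(m_par x - l)\<^sup>2 = (m_par x)\<^sup>2 - l * (2 * m_par x - l)"
      by (simp add: power2_eq_square algebra_simps)
    moreover have "4 * \<bar>m_par x - l\<bar> powr (3/2) / sqrt (real N * (real N + 1)) = 4 * w"
      by (simp add: w_def)
    ultimately show ?thesis
      using r by (simp only: power2_abs) (simp add: algebra_simps)
  qed
  have rho: "spearman_rho (opt_copula x) = rho_bar x" if "N \<ge> 1" "x \<in> I_int N" for N x
    using rho_bar_eq_maximizer[OF max[OF that]] by simp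
  have rho1: "rho_bar 1 = 1"
    using rho_bar_eq_maximizer[OF max1] upper_Frechet(3) by simp
  show ?thesis
  proof (intro conjI allI impI)
    fix N :: nat and x :: real assume Nx: "N \<ge> 1" "x \<in> I_int N"
    show "m_par x \<in> {1 / (2 * real N + 2) .. 1 / (2 * real N)}" by (rule m[OF Nx])
    show "symmetric_copula (opt_copula x)" "footrule (opt_copula x) = x"
      by (rule opt_copula_optimal[OF Nx])+
    show "spearman_rho (opt_copula x) = rho_bar x" by (rule rho[OF Nx])
    show "copula_eq D (opt_copula x)"
      if "is_copula D \<and> spearman_rho D = rho_bar x \<and> footrule D = x" for D
      using that opt_copula_optimal(4)[OF Nx, of D] rho[OF Nx] by simp
    show "let m = m_par x; \<Delta> = \<bar>m - l\<bar> in
        rho_bar x = 1 - 6 * l * (2 * m - l) - 4 * \<Delta> powr (3/2) / sqrt (real N * (real N + 1))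
      \<and> rho_bar x = u_bound x - (4 * \<Delta> powr (3/2) / sqrt (real N * (real N + 1)) - 6 * \<Delta>\<^sup>2)"
      if "l \<in> {1 / (2 * real N), 1 / (2 * real N + 2)}"
        "\<forall>e\<in>{1 / (2 * real N), 1 / (2 * real N + 2)}. \<bar>m_par x - l\<bar> \<le> \<bar>m_par x - e\<bar>" for l
      unfolding Let_def by (rule formula[OF Nx that])
  next
    show "copula_eq D (opt_copula 1)"
      if "is_copula D \<and> spearman_rho D = rho_bar 1 \<and> footrule D = 1" for D
      using that upper_Frechet(5) by simp
  qed (use exists rho1 upper_Frechet(1,2,3) in auto)
qed

end
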